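(* Let $\{x_i\}_{i\in\{0,1,\dots,N\}}$ be the solution to the pointwise-delay system (P) with continuous initial data on $[-\bar\tau,0]$, where the control $u$ is the feedback control (C) (both described in the context). Let $$R:=\max_{s\in[-\bar\tau,0]}\ \max_{i=0,1,\dots,N}|x_i(s)|,\qquad R_\gamma:=\gamma L R+\gamma+1 .$$ If $$\bar\tau<\ln\left(1+\frac{\gamma\,\phi(2R)}{\gamma(1+2\gamma)\phi(2R)+4(1+\gamma)R_\gamma}\right),$$ then there exist constants $\beta^*,C>0$ such that, for any $t\ge 0$, $$d_0(t)\le C e^{-\beta^* t},\qquad\text{where } d_0(t):=\max_{i\in\{1,\dots,N\}}|x_i(t)-x_0(t)| .$$
   Context: Setting. $N,d\in\mathbb{N}$, $|\cdot|$ is the Euclidean norm on $\mathbb{R}^d$, $\gamma>0$, $M>0$, $\bar\tau>0$ are constants. The delay $\tau:[0,+\infty)\to[0,+\infty)$ is continuous with $\tau(t)\le\bar\tau$ for all $t\ge0$. The function $a:[0,+\infty)\to[0,+\infty)$ is continuous and non-increasing, with $a(s)=1$ for $s\in[0,\delta]$ and $a(s)=0$ for $s\ge r$, where $r>\delta>0$. The function $\phi:[0,+\infty)\to(0,+\infty)$ is non-increasing and Lipschitz continuous with Lipschitz constant $L>0$, and $\phi(0)=1$. System (P): $x_0$ (leader) and $x_1,\dots,x_N$ (agents) are $\mathbb{R}^d$-valued functions with, for $t\ge0$ and $i=1,\dots,N$, $$\frac{dx_0}{dt}(t)=u(t),$$ $$\frac{dx_i}{dt}(t)=\frac1N\sum_{j\in\{1,\dots,N\},\,j\ne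 i}a_{ij}(t)\,(x_j(t-\tau(t))-x_i(t))+\gamma\,\phi(|x_0(t-\tau(t))-x_i(t)|)\,(x_0(t-\tau(t))-x_i(t)),$$ where $a_{ij}(t)=a(|x_j(t-\tau(t))-x_i(t)|)$, and with prescribed continuous initial data $x_i(s)=x_{i,0}(s)$, $s\in[-\bar\tau,0]$, $i=0,1,\dots,N$. A solution consists of continuous functions on $[-\bar\tau,+\infty)$, locally absolutely continuous on $[0,+\infty)$, satisfying the equations for almost every $t\ge0$. Control (C): for each $t\ge 0$ let $p=p(t)\in\{1,\dots,N\}$ be an index with $|x_p(t)-x_0(t)|=\max_{i\in\{1,\dots,N\}}|x_i(t)-x_0(t)|$; then $$u(t)=\gamma\,\alpha(t)\sum_{j=1}^N\phi(|x_j(t-\tau(t))-x_0(t)|)\,(x_j(t-\tau(t))-x_0(t)),$$ $$\alpha(t)=\frac12\min\left\{\frac{\phi(|x_{p(t)}(t-\tau(t))-x_0(t)|)}{N},\ \frac{2M}{\gamma\sum_{j=1}^N|x_j(t-\tau(t))-x_0(t)|}\right\},$$ the second entry of the minimum being read as $+\infty$ when its denominator vanishes. *)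

theory Defs
  imports "HOL-Analysis.Analysis"
begin

(* The epsilon-delta notion of absolute continuity for functions on a real interval; the library's
   absolutely_continuous is the unrelated notion for measures. *)
definition abs_continuous_on :: "real set \<Rightarrow> (real \<Rightarrow> 'a::real_normed_vector) \<Rightarrow> bool" where
  "abs_continuous_on S f \<longleftrightarrow>
     (\<forall>\<epsilon>>0. \<exists>\<eta>>0. \<forall>(n::nat) b c.
        (\<forall>k<n. b k \<le> c k \<and> {b k..c k} \<subseteq> S) \<longrightarrow>
        disjoint_family_on (\<lambda>k. {b k<..<c k}) {..<n} \<longrightarrow>
        (\<Sum>k<n. c k - b k) < \<eta> \<longrightarrow>
        (\<Sum>k<n. norm (f (c k) - f (b k))) < \<epsilon>)"

definition locally_abs_continuous_halfline :: "(real \<Rightarrow> 'a::real_normed_vector) \<Rightarrow> bool" where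
  "locally_abs_continuous_halfline f \<longleftrightarrow> (\<forall>T>0. abs_continuous_on {0..T} f)"

(* Right-hand side of the equation of agent i. The family x collects the leader (index 0) and the
   agents (indices 1..N). *)
definition agent_rhs ::
  "nat \<Rightarrow> real \<Rightarrow> (real \<Rightarrow> real) \<Rightarrow> (real \<Rightarrow> real) \<Rightarrow> (real \<Rightarrow> real) \<Rightarrow>
   (nat \<Rightarrow> real \<Rightarrow> real ^ 'd) \<Rightarrow> nat \<Rightarrow> real \<Rightarrow> real ^ 'd" where
  "agent_rhs N \<gamma> \<tau> a \<phi> x i t =
     (1 / real N) *\<^sub>R
       (\<Sum>j\<in>{1..N} - {i}. a (norm (x j (t - \<tau> t) - x i t)) *\<^sub>R (x j (t - \<tau> t) - x i t))
     + (\<gamma> * \<phi> (norm (x 0 (t - \<tau> t) - x i t))) *\<^sub>R (x 0 (t - \<tau> t) - x i t)"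

(* The values of the trajectories at times before -tb are irrelevant. *)
definition solves_P ::
  "nat \<Rightarrow> real \<Rightarrow> real \<Rightarrow> (real \<Rightarrow> real) \<Rightarrow> (real \<Rightarrow> real) \<Rightarrow> (real \<Rightarrow> real) \<Rightarrow>
   (nat \<Rightarrow> real \<Rightarrow> real ^ 'd) \<Rightarrow> (real \<Rightarrow> real ^ 'd) \<Rightarrow> (nat \<Rightarrow> real \<Rightarrow> real ^ 'd) \<Rightarrow> bool" where
  "solves_P N \<gamma> tb \<tau> a \<phi> x_init u x \<longleftrightarrow>
     (\<forall>i\<in>{0..N}. continuous_on {-tb..} (x i)) \<and>
     (\<forall>i\<in>{0..N}. locally_abs_continuous_halfline (x i)) \<and>
     (\<forall>i\<in>{0..N}. \<forall>s\<in>{-tb..0}. x i s = x_init i s) \<and>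
     (AE t in lebesgue. t \<ge> 0 \<longrightarrow>
        (x 0 has_vector_derivative u t) (at t within {0..})) \<and>
     (\<forall>i\<in>{1..N}. AE t in lebesgue. t \<ge> 0 \<longrightarrow>
        (x i has_vector_derivative agent_rhs N \<gamma> \<tau> a \<phi> x i t) (at t within {0..}))"

definition leader_dist :: "nat \<Rightarrow> (nat \<Rightarrow> real \<Rightarrow> real ^ 'd) \<Rightarrow> real \<Rightarrow> real" where
  "leader_dist N x t = Max ((\<lambda>i. norm (x i t - x 0 t)) ` {1..N})"

definition farthest_selection :: "nat \<Rightarrow> (nat \<Rightarrow> real \<Rightarrow> real ^ 'd) \<Rightarrow> (real \<Rightarrow> nat) \<Rightarrow> bool" where
  "farthest_selection N x p \<longleftrightarrow>
     (\<forall>t\<ge>0. p t \<in> {1..N} \<and> norm (x (p t) t - x 0 t) = leader_dist N x t)"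

(* The second entry of the minimum counts as infinite when its denominator vanishes. *)
definition control_gain ::
  "nat \<Rightarrow> real \<Rightarrow> real \<Rightarrow> (real \<Rightarrow> real) \<Rightarrow> (real \<Rightarrow> real) \<Rightarrow> (nat \<Rightarrow> real \<Rightarrow> real ^ 'd) \<Rightarrow>
   (real \<Rightarrow> nat) \<Rightarrow> real \<Rightarrow> real" where
  "control_gain N \<gamma> M \<tau> \<phi> x p t =
     (let q = \<phi> (norm (x (p t) (t - \<tau> t) - x 0 t)) / real N;
          D = \<gamma> * (\<Sum>j=1..N. norm (x j (t - \<tau> t) - x 0 t))
      in 1 / 2 * (if D = 0 then q else min q (2 * M / D)))"

definition feedback_control ::
  "nat \<Rightarrow> real \<Rightarrow> real \<Rightarrow> (real \<Rightarrow> real) \<Rightarrow> (real \<Rightarrow> real) \<Rightarrow> (nat \<Rightarrow> real \<Rightarrow> real ^ 'd) \<Rightarrow>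
   (real \<Rightarrow> nat) \<Rightarrow> real \<Rightarrow> real ^ 'd" where
  "feedback_control N \<gamma> M \<tau> \<phi> x p t =
     (\<gamma> * control_gain N \<gamma> M \<tau> \<phi> x p t) *\<^sub>R
       (\<Sum>j=1..N. \<phi> (norm (x j (t - \<tau> t) - x 0 t)) *\<^sub>R (x j (t - \<tau> t) - x 0 t))"

(* For trajectories continuous on {-tb..0} and tb >= 0 the supremum is attained, hence a maximum. *)
definition initial_radius :: "nat \<Rightarrow> real \<Rightarrow> (nat \<Rightarrow> real \<Rightarrow> real ^ 'd) \<Rightarrow> real" where
  "initial_radius N tb x = (SUP s\<in>{-tb..0}. Max ((\<lambda>i. norm (x i s)) ` {0..N}))"

end

theory Submission
  imports Defs
begin

text \<open>
  Let \<open>d\<close> be the largest distance of an agent to the leader, and let \<open>E\<close> bound, over the past window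
  of length \<open>tb\<close>, the displacement of the leader plus that of any one agent. Three facts make \<open>d\<close> decay.

  First, everybody is attracted to past positions of others, so all trajectories stay in the ball of
  radius \<open>R\<close> (\<open>bounded_by_initial_radius\<close>). In particular every attraction weight is at least
  \<open>\<phi> (2 * R)\<close>.

  Second, an agent is attracted by the leader with strength \<open>\<gamma>\<close> times its own weight, and the leader
  escapes, or approaches, with at most half the strength that corresponds to the farthest agent.
  By monotonicity and Lipschitz continuity of \<open>\<phi>\<close> the latter weight exceeds the former by at
  most \<open>L * E\<close> (\<open>farthest_weight_le\<close>). Up to delay errors, \<open>d\<close> is thus damped at the rate
  \<open>\<gamma> * \<phi> (2 * R) / 2\<close>, and these errors have size \<open>(\<gamma> * L * R + \<gamma> + 1) * E\<close>
  (\<open>inner_relative_velocity_le\<close>).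

  Third, the speeds are bounded linearly in \<open>d\<close> and \<open>E\<close>, and integrating them over a window of length
  \<open>tb\<close> bounds \<open>E\<close> by \<open>tb\<close> times such a linear expression (\<open>delay_spread_improves\<close>).

  If \<open>tb\<close> is small, the last two facts form a contraction on bounds of the form
  \<open>d \<le> Z * A * exp (- \<beta> * t)\<close>, \<open>E \<le> Z * B * exp (- \<beta> * t)\<close>: any such bound on a finite time interval
  implies the same bound with a smaller \<open>Z\<close>, down to a floor that does not depend on the interval
  (\<open>decays_if_contraction\<close>).

  The solutions satisfy their equations only almost everywhere, and \<open>d\<close> is a maximum of norms. Both
  points are handled by a barrier principle (\<open>norm_le_barrier\<close>): the vector in question is paired with
  one fixed unit vector, which yields an absolutely continuous scalar function, and such a function
  cannot cross a barrier if its derivative has the right sign almost everywhere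
  (\<open>abs_continuous_on_nonincreasing\<close>).
\<close>

section \<open>Absolutely continuous functions whose derivative has a sign\<close>

text \<open>One criterion covers every way in which absolute continuity is transported below: differences,
  inner products with a fixed unit vector, and the combination of both with a smooth barrier all have
  increments bounded by the increments of two absolutely continuous functions.\<close>

lemma abs_continuous_on_dominated:
  fixes f :: "real \<Rightarrow> 'a::real_normed_vector" and g :: "real \<Rightarrow> 'b::real_normed_vector"
    and h :: "real \<Rightarrow> 'c::real_normed_vector"
  assumes f: "abs_continuous_on S f" and g: "abs_continuous_on S g"
    and h: "\<And>s t. s \<in> S \<Longrightarrow> t \<in> S \<Longrightarrow> norm (h t - h s) \<le> norm (f t - f s) + norm (g t - g s)"
  shows "abs_continuous_on S h"
  unfolding abs_continuous_on_def
proof (intro allI impI)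
  fix \<epsilon> :: real assume "\<epsilon> > 0"
  then have e2: "\<epsilon> / 2 > 0" by simp
  obtain \<eta>1 where \<eta>1: "\<eta>1 > 0" "\<And>(n::nat) b c. (\<forall>k<n. b k \<le> c k \<and> {b k..c k} \<subseteq> S) \<Longrightarrow>
        disjoint_family_on (\<lambda>k. {b k<..<c k}) {..<n} \<Longrightarrow> (\<Sum>k<n. c k - b k) < \<eta>1 \<Longrightarrow>
        (\<Sum>k<n. norm (f (c k) - f (b k))) < \<epsilon> / 2"
    using f e2 unfolding abs_continuous_on_def by meson
  obtain \<eta>2 where \<eta>2: "\<eta>2 > 0" "\<And>(n::nat) b c. (\<forall>k<n. b k \<le> c k \<and> {b k..c k} \<subseteq> S) \<Longrightarrow>
        disjoint_family_on (\<lambda>k. {b k<..<c k}) {..<n} \<Longrightarrow> (\<Sum>k<n. c k - b k) < \<eta>2 \<Longrightarrow>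
        (\<Sum>k<n. norm (g (c k) - g (b k))) < \<epsilon> / 2"
    using g e2 unfolding abs_continuous_on_def by meson
  show "\<exists>\<eta>>0. \<forall>(n::nat) b c.
        (\<forall>k<n. b k \<le> c k \<and> {b k..c k} \<subseteq> S) \<longrightarrow>
        disjoint_family_on (\<lambda>k. {b k<..<c k}) {..<n} \<longrightarrow>
        (\<Sum>k<n. c k - b k) < \<eta> \<longrightarrow> (\<Sum>k<n. norm (h (c k) - h (b k))) < \<epsilon>"
  proof (intro exI[of _ "min \<eta>1 \<eta>2"] conjI allI impI)
    show "0 < min \<eta>1 \<eta>2" using \<eta>1 \<eta>2 by simp
    fix n :: nat and b c :: "nat \<Rightarrow> real"
    assume bc: "\<forall>k<n. b k \<le> c k \<and> {b k..c k} \<subseteq> S"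
      and dis: "disjoint_family_on (\<lambda>k. {b k<..<c k}) {..<n}"
      and len: "(\<Sum>k<n. c k - b k) < min \<eta>1 \<eta>2"
    have "(\<Sum>k<n. norm (h (c k) - h (b k)))
        \<le> (\<Sum>k<n. norm (f (c k) - f (b k)) + norm (g (c k) - g (b k)))"
      using bc by (intro sum_mono h) force+
    also have "\<dots> = (\<Sum>k<n. norm (f (c k) - f (b k))) + (\<Sum>k<n. norm (g (c k) - g (b k)))"
      by (simp add: sum.distrib)
    also have "\<dots> < \<epsilon> / 2 + \<epsilon> / 2"
      using len by (intro add_strict_mono \<eta>1(2)[OF bc dis] \<eta>2(2)[OF bc dis]) auto
    finally show "(\<Sum>k<n. norm (h (c k) - h (b k))) < \<epsilon>" by simp
  qed
qed

lemma abs_continuous_on_lipschitz: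
  fixes g :: "real \<Rightarrow> real"
  assumes "C > 0" "\<And>s t. s \<in> S \<Longrightarrow> t \<in> S \<Longrightarrow> \<bar>g t - g s\<bar> \<le> C * \<bar>t - s\<bar>"
  shows "abs_continuous_on S g"
  unfolding abs_continuous_on_def
proof (intro allI impI)
  fix \<epsilon> :: real assume "\<epsilon> > 0"
  show "\<exists>\<eta>>0. \<forall>(n::nat) b c.
        (\<forall>k<n. b k \<le> c k \<and> {b k..c k} \<subseteq> S) \<longrightarrow>
        disjoint_family_on (\<lambda>k. {b k<..<c k}) {..<n} \<longrightarrow>
        (\<Sum>k<n. c k - b k) < \<eta> \<longrightarrow> (\<Sum>k<n. norm (g (c k) - g (b k))) < \<epsilon>"
  proof (intro exI[of _ "\<epsilon> / C"] conjI allI impI)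
    show "\<epsilon> / C > 0" using \<open>\<epsilon> > 0\<close> assms by simp
    fix n :: nat and b c :: "nat \<Rightarrow> real"
    assume bc: "\<forall>k<n. b k \<le> c k \<and> {b k..c k} \<subseteq> S" and len: "(\<Sum>k<n. c k - b k) < \<epsilon> / C"
    have "(\<Sum>k<n. norm (g (c k) - g (b k))) \<le> (\<Sum>k<n. C * (c k - b k))"
    proof (rule sum_mono)
      fix k assume "k \<in> {..<n}"
      then have "b k \<le> c k" "b k \<in> S" "c k \<in> S" using bc by force+
      then show "norm (g (c k) - g (b k)) \<le> C * (c k - b k)" using assms(2)[of "b k" "c k"] by simp
    qed
    also have "\<dots> = C * (\<Sum>k<n. c k - b k)" by (simp add: sum_distrib_left)
    also have "\<dots> < \<epsilon>" using len assms(1) by (simp add: field_simps)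
    finally show "(\<Sum>k<n. norm (g (c k) - g (b k))) < \<epsilon>" .
  qed
qed

lemma abs_continuous_on_subset: "abs_continuous_on T f \<Longrightarrow> S \<subseteq> T \<Longrightarrow> abs_continuous_on S f"
  unfolding abs_continuous_on_def by (meson order_trans)

lemma abs_continuous_on_imp_continuous_on:
  fixes f :: "real \<Rightarrow> 'a::real_normed_vector"
  assumes "abs_continuous_on {a..b} f"
  shows "continuous_on {a..b} f"
  unfolding continuous_on_iff
proof (intro ballI allI impI)
  fix x \<epsilon> :: real assume x: "x \<in> {a..b}" and "\<epsilon> > 0"
  obtain \<eta> where \<eta>: "\<eta> > 0" "\<And>(n::nat) u v. (\<forall>k<n. u k \<le> v k \<and> {u k..v k} \<subseteq> {a..b}) \<Longrightarrow>
        disjoint_family_on (\<lambda>k. {u k<..<v k}) {..<n} \<Longrightarrow> (\<Sum>k<n. v k - u k) < \<eta> \<Longrightarrow>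
        (\<Sum>k<n. norm (f (v k) - f (u k))) < \<epsilon>"
    using assms \<open>\<epsilon> > 0\<close> unfolding abs_continuous_on_def by meson
  show "\<exists>d>0. \<forall>x'\<in>{a..b}. dist x' x < d \<longrightarrow> dist (f x') (f x) < \<epsilon>"
  proof (intro exI[of _ \<eta>] conjI ballI impI \<eta>(1))
    fix y assume y: "y \<in> {a..b}" and d: "dist y x < \<eta>"
    have "norm (f (max x y) - f (min x y)) < \<epsilon>"
      using \<eta>(2)[of 1 "\<lambda>_. min x y" "\<lambda>_. max x y"] x y d
      by (auto simp: disjoint_family_on_def dist_real_def max_def min_def split: if_splits)
    then show "dist (f y) (f x) < \<epsilon>"
      by (auto simp: dist_norm norm_minus_commute max_def min_def split: if_splits)
  qed
qed

lemma negligible_outer_open: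
  fixes S :: "real set"
  assumes "negligible S" "\<eta> > 0"
  obtains U where "open U" "S \<subseteq> U" "U \<in> lmeasurable" "measure lebesgue U < \<eta>"
proof -
  have S: "S \<in> null_sets lebesgue" using assms(1) by (simp add: negligible_iff_null_sets)
  then have "S \<in> sets lebesgue" by auto
  then obtain U where U: "open U" "S \<subseteq> U" "U - S \<in> lmeasurable" "emeasure lebesgue (U - S) < ennreal \<eta>"
    using sets_lebesgue_outer_open[OF _ assms(2)] by blast
  have "measure lebesgue (U - S) < \<eta>"
    using U(3,4) \<open>\<eta> > 0\<close> by (simp add: emeasure_eq_measure2 ennreal_less_iff)
  moreover have "U \<in> lmeasurable" "measure lebesgue U = measure lebesgue (U - S)"
  proof -
    have "U = (U - S) \<union> S" using U(2) by auto
    then show "U \<in> lmeasurable"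
      using U(3) assms(1) negligible_imp_measurable fmeasurable.Un by metis
    show "measure lebesgue U = measure lebesgue (U - S)"
      using S U(1) measure_Diff_null_set[of U lebesgue S] by auto
  qed
  ultimately show thesis using that[OF U(1,2)] by simp
qed

text \<open>Absolute continuity speaks about disjoint open intervals of small total length, whereas a gauge
  argument produces the pieces of a tagged division. The pieces that lie in a set \<open>U\<close> of small
  measure are of the former kind, since their interiors are disjoint and fill at most the measure of
  \<open>U\<close>.\<close>

lemma abs_continuous_on_small_over_tags:
  fixes f :: "real \<Rightarrow> 'a::real_normed_vector"
  assumes ac: "abs_continuous_on {a..b} f" and "\<epsilon> > 0"
  obtains \<eta> where "\<eta> > 0"
    "\<And>q U. q tagged_partial_division_of {a..b} \<Longrightarrow> U \<in> lmeasurable \<Longrightarrow> measure lebesgue U < \<eta> \<Longrightarrow>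
       (\<And>x K. (x, K) \<in> q \<Longrightarrow> K \<subseteq> U) \<Longrightarrow> (\<Sum>(x, K)\<in>q. norm (f (Sup K) - f (Inf K))) < \<epsilon>"
proof -
  obtain \<eta> where \<eta>: "\<eta> > 0" "\<And>(n::nat) u v. (\<forall>k<n. u k \<le> v k \<and> {u k..v k} \<subseteq> {a..b}) \<Longrightarrow>
        disjoint_family_on (\<lambda>k. {u k<..<v k}) {..<n} \<Longrightarrow> (\<Sum>k<n. v k - u k) < \<eta> \<Longrightarrow>
        (\<Sum>k<n. norm (f (v k) - f (u k))) < \<epsilon>"
    using assms unfolding abs_continuous_on_def by meson
  show thesis
  proof (rule that[OF \<eta>(1)])
    fix q U assume q: "q tagged_partial_division_of {a..b}" and U: "U \<in> lmeasurable" "measure lebesgue U < \<eta>"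
      and qU: "\<And>x K. (x, K) \<in> q \<Longrightarrow> K \<subseteq> U"
    note qD = tagged_partial_division_ofD[OF q]
    obtain e where e: "bij_betw e {0..<card q} q"
      using ex_bij_betw_nat_finite[OF qD(1)] by blast
    define n where "n = card q"
    have e: "bij_betw e {..<n} q" using e by (simp add: n_def atLeast0LessThan)
    define u v where "u k = Inf (snd (e k))" and "v k = Sup (snd (e k))" for k
    have K: "u k \<le> v k \<and> snd (e k) = {u k..v k} \<and> (fst (e k), snd (e k)) \<in> q" if "k < n" for k
    proof -
      have mem: "(fst (e k), snd (e k)) \<in> q" using e that by (auto simp: bij_betw_def)
      obtain y z where yz: "snd (e k) = cbox y z" using qD(4)[OF mem] by blast
      have "fst (e k) \<in> snd (e k)" using qD(2)[OF mem] .
      then have "y \<le> z" using yz by auto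
      then show ?thesis using mem yz by (auto simp: u_def v_def)
    qed
    have dis: "disjoint_family_on (\<lambda>k. {u k<..<v k}) {..<n}"
      unfolding disjoint_family_on_def
    proof (intro ballI impI)
      fix k l assume kl: "k \<in> {..<n}" "l \<in> {..<n}" "k \<noteq> l"
      then have "e k \<noteq> e l" using e by (auto simp: bij_betw_def inj_on_def)
      moreover have "(fst (e k), snd (e k)) \<in> q" "(fst (e l), snd (e l)) \<in> q" using K kl by blast+
      ultimately have "interior (snd (e k)) \<inter> interior (snd (e l)) = {}"
        using qD(5) by (metis prod.collapse)
      then show "{u k<..<v k} \<inter> {u l<..<v l} = {}" using K kl by (simp add: interior_atLeastAtMost_real)
    qed
    have "(\<Sum>k<n. v k - u k) = (\<Sum>k<n. measure lebesgue {u k<..<v k})"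
      using K by (intro sum.cong) auto
    also have "\<dots> = measure lebesgue (\<Union>k<n. {u k<..<v k})"
      using dis K by (intro measure_finite_Union[symmetric]) auto
    also have "\<dots> \<le> measure lebesgue U"
    proof (rule measure_mono_fmeasurable)
      show "(\<Union>k<n. {u k<..<v k}) \<subseteq> U"
      proof (rule UN_least)
        fix k assume "k \<in> {..<n}"
        then have "k < n" by simp
        then have "snd (e k) \<subseteq> U" using K qU by blast
        then have "{u k..v k} \<subseteq> U" using K[OF \<open>k < n\<close>] by simp
        then show "{u k<..<v k} \<subseteq> U" using greaterThanLessThan_subseteq_atLeastAtMost_iff by fastforce
      qed
    qed (use U in auto)
    also have "\<dots> < \<eta>" by (rule U)
    finally have len: "(\<Sum>k<n. v k - u k) < \<eta>" .
    have "(\<Sum>(x, K)\<in>q. norm (f (Sup K) - f (Inf K))) = (\<Sum>k<n. norm (f (v k) - f (u k)))"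
      by (subst sum.reindex_bij_betw[OF e, symmetric]) (auto simp: u_def v_def case_prod_beta)
    also have "\<dots> < \<epsilon>"
    proof (intro \<eta>(2) dis len allI impI)
      fix k assume "k < n"
      then have "snd (e k) \<subseteq> {a..b}" using K qD(3) by blast
      then show "u k \<le> v k \<and> {u k..v k} \<subseteq> {a..b}" using K[OF \<open>k < n\<close>] by simp
    qed
    finally show "(\<Sum>(x, K)\<in>q. norm (f (Sup K) - f (Inf K))) < \<epsilon>" .
  qed
qed

text \<open>The interval must contain the point \<open>x\<close> in the middle: then the error terms on the two sides add
  up to a multiple of the full length. This is the form that matches the pieces of a tagged
  division, which contain their tags.\<close>

lemma has_real_derivative_nonpos_straddle:
  fixes f :: "real \<Rightarrow> real"
  assumes f': "(f has_real_derivative D) (at x within S)" and "D \<le> 0" "\<epsilon> > 0"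
  obtains d where "d > 0"
    "\<And>u v. u \<in> S \<Longrightarrow> v \<in> S \<Longrightarrow> u \<le> x \<Longrightarrow> x \<le> v \<Longrightarrow> u \<in> ball x d \<Longrightarrow> v \<in> ball x d \<Longrightarrow>
       f v - f u \<le> \<epsilon> * (v - u)"
proof -
  obtain d where d: "d > 0"
    "\<And>y. y \<in> S \<Longrightarrow> norm (y - x) < d \<Longrightarrow> norm (f y - f x - D * (y - x)) \<le> \<epsilon> * norm (y - x)"
    using f' \<open>\<epsilon> > 0\<close> unfolding has_field_derivative_def has_derivative_within_alt by meson
  show thesis
  proof (rule that[OF d(1)])
    fix u v assume uv: "u \<in> S" "v \<in> S" "u \<le> x" "x \<le> v" "u \<in> ball x d" "v \<in> ball x d"
    have "\<bar>f v - f x - D * (v - x)\<bar> \<le> \<epsilon> * (v - x)" "\<bar>f u - f x - D * (u - x)\<bar> \<le> \<epsilon> * (x - u)"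
      using d(2)[of v] d(2)[of u] uv by (auto simp: dist_real_def)
    moreover have "D * (v - x) \<le> 0" "D * (x - u) \<le> 0"
      using uv \<open>D \<le> 0\<close> by (auto simp: mult_le_0_iff)
    ultimately show "f v - f u \<le> \<epsilon> * (v - u)" by (simp add: algebra_simps abs_le_iff)
  qed
qed

text \<open>Choose a gauge that is governed by the derivative at the good points and that confines the pieces
  tagged in the exceptional null set \<open>S\<close> to an open set of small measure. In a division fine for this
  gauge, the pieces with good tags contribute at most \<open>\<epsilon> * (b - a)\<close> to the telescoping sum for
  \<open>f b - f a\<close>, and absolute continuity makes the contribution of the others smaller than \<open>\<epsilon>\<close>.\<close>

theorem abs_continuous_on_nonincreasing:
  fixes f :: "real \<Rightarrow> real"
  assumes "a \<le> b" and ac: "abs_continuous_on {a..b} f" and S: "negligible S"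
    and f': "\<And>t. t \<in> {a..b} \<Longrightarrow> t \<notin> S \<Longrightarrow> \<exists>D\<le>0. (f has_real_derivative D) (at t within {a..b})"
  shows "f b \<le> f a"
proof (rule field_le_epsilon)
  fix e :: real assume "e > 0"
  \<comment> \<open>Good tags cost \<open>\<epsilon> * (b - a)\<close> and bad ones one further \<open>\<epsilon>\<close>; together this is \<open>e\<close>.\<close>
  define \<epsilon> where "\<epsilon> = e / (b - a + 1)"
  have "\<epsilon> > 0" "\<epsilon> * (b - a + 1) = e"
    using \<open>e > 0\<close> \<open>a \<le> b\<close> by (auto simp: \<epsilon>_def)
  then have \<epsilon>: "\<epsilon> > 0" "\<epsilon> * (b - a) + \<epsilon> = e" by (auto simp: algebra_simps)
  obtain \<eta> where \<eta>: "\<eta> > 0"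
    "\<And>q U. q tagged_partial_division_of {a..b} \<Longrightarrow> U \<in> lmeasurable \<Longrightarrow> measure lebesgue U < \<eta> \<Longrightarrow>
       (\<And>x K. (x, K) \<in> q \<Longrightarrow> K \<subseteq> U) \<Longrightarrow> (\<Sum>(x, K)\<in>q. norm (f (Sup K) - f (Inf K))) < \<epsilon>"
    using abs_continuous_on_small_over_tags[OF ac \<epsilon>(1)] by blast
  obtain U where U: "open U" "S \<subseteq> U" "U \<in> lmeasurable" "measure lebesgue U < \<eta>"
    using negligible_outer_open[OF S \<eta>(1)] by blast
  have "\<exists>d>0. \<forall>u v. u \<in> {a..b} \<longrightarrow> v \<in> {a..b} \<longrightarrow> u \<le> t \<longrightarrow> t \<le> v \<longrightarrow> u \<in> ball t d \<longrightarrow> v \<in> ball t d \<longrightarrow>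
       f v - f u \<le> \<epsilon> * (v - u)" if "t \<in> {a..b}" "t \<notin> S" for t
    using f'[OF that] has_real_derivative_nonpos_straddle \<epsilon>(1) by metis
  then obtain d where d: "\<And>t. t \<in> {a..b} \<Longrightarrow> t \<notin> S \<Longrightarrow> d t > 0"
    "\<And>t u v. t \<in> {a..b} \<Longrightarrow> t \<notin> S \<Longrightarrow> u \<in> {a..b} \<Longrightarrow> v \<in> {a..b} \<Longrightarrow> u \<le> t \<Longrightarrow> t \<le> v \<Longrightarrow>
       u \<in> ball t (d t) \<Longrightarrow> v \<in> ball t (d t) \<Longrightarrow> f v - f u \<le> \<epsilon> * (v - u)"
    by metis
  define G where "G t = (if t \<in> S then U else if t \<in> {a..b} then ball t (d t) else ball t 1)" for t
  have "gauge G" using U d(1) by (auto simp: gauge_def G_def)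
  then obtain p where p: "p tagged_division_of {a..b}" "G fine p"
    using fine_division_exists_real by blast
  note pD = tagged_division_ofD[OF p(1)]
  define q where "q = {z \<in> p. fst z \<in> S}"
  have fin: "finite p" using pD(1) .
  have q: "q tagged_partial_division_of {a..b}"
    using tagged_partial_division_subset[of p "{a..b}" q] p(1) by (auto simp: q_def tagged_division_of_def)
  have small: "(\<Sum>(x, K)\<in>q. norm (f (Sup K) - f (Inf K))) < \<epsilon>"
    using p(2) by (intro \<eta>(2)[OF q U(3,4)]) (force simp: q_def fine_def G_def)
  have "(\<Sum>(x, K)\<in>q. f (Sup K) - f (Inf K)) \<le> (\<Sum>(x, K)\<in>q. norm (f (Sup K) - f (Inf K)))"
    by (intro sum_mono) auto
  then have A: "(\<Sum>(x, K)\<in>q. f (Sup K) - f (Inf K)) \<le> \<epsilon>" using small by linarith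
  have len: "0 \<le> \<epsilon> * (Sup K - Inf K)" and
    B: "x \<notin> S \<Longrightarrow> f (Sup K) - f (Inf K) \<le> \<epsilon> * (Sup K - Inf K)" if xK: "(x, K) \<in> p" for x K
  proof -
    obtain u v where uv: "K = cbox u v" using pD(4)[OF xK] by blast
    have x: "x \<in> K" "K \<subseteq> {a..b}" using pD(2,3)[OF xK] by auto
    then have *: "u \<le> x" "x \<le> v" "u \<in> {a..b}" "v \<in> {a..b}" "Sup K = v" "Inf K = u" using uv by auto
    show "0 \<le> \<epsilon> * (Sup K - Inf K)" using * \<epsilon>(1) by simp
    assume "x \<notin> S"
    then have "K \<subseteq> ball x (d x)" using p(2) xK x by (force simp: fine_def G_def)
    moreover have "u \<in> K" "v \<in> K" using uv * by auto
    ultimately have "u \<in> ball x (d x)" "v \<in> ball x (d x)" by blast+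
    then show "f (Sup K) - f (Inf K) \<le> \<epsilon> * (Sup K - Inf K)"
      using d(2)[of x u v] * x \<open>x \<notin> S\<close> by auto
  qed
  have "f b - f a = (\<Sum>(x, K)\<in>p. f (Sup K) - f (Inf K))"
    using additive_tagged_division_1[OF \<open>a \<le> b\<close> p(1), of f] by simp
  also have "\<dots> = (\<Sum>(x, K)\<in>p - q. f (Sup K) - f (Inf K)) + (\<Sum>(x, K)\<in>q. f (Sup K) - f (Inf K))"
    using fin by (intro sum.subset_diff) (auto simp: q_def)
  also have "(\<Sum>(x, K)\<in>p - q. f (Sup K) - f (Inf K)) \<le> (\<Sum>(x, K)\<in>p - q. \<epsilon> * (Sup K - Inf K))"
    using B by (intro sum_mono) (auto simp: q_def)
  also have "\<dots> \<le> (\<Sum>(x, K)\<in>p. \<epsilon> * (Sup K - Inf K))"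
    using fin len by (intro sum_mono2) auto
  also have "\<dots> = \<epsilon> * (b - a)"
    using additive_tagged_division_1[OF \<open>a \<le> b\<close> p(1), of "\<lambda>x. \<epsilon> * x"] by (simp add: algebra_simps)
  finally show "f b \<le> f a + e" using A \<epsilon>(2) by linarith
qed

text \<open>After the last time \<open>c\<close> at which \<open>h\<close> is nonpositive, \<open>h\<close> is positive and so its derivative has
  the sign that prevents it from growing above \<open>h c\<close>.\<close>

lemma abs_continuous_on_stays_nonpos:
  fixes h :: "real \<Rightarrow> real"
  assumes "a \<le> b" and ac: "abs_continuous_on {a..b} h" and S: "negligible S"
    and h': "\<And>t. t \<in> {a..b} \<Longrightarrow> t \<notin> S \<Longrightarrow>
       \<exists>D. (h has_real_derivative D) (at t within {a..b}) \<and> (h t \<ge> 0 \<longrightarrow> D \<le> 0)"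
    and "h a \<le> 0"
  shows "h b \<le> 0"
proof (rule ccontr)
  assume "\<not> h b \<le> 0"
  define C where "C = {t \<in> {a..b}. h t \<le> 0}"
  have cont: "continuous_on {a..b} h" by (rule abs_continuous_on_imp_continuous_on[OF ac])
  have "closed C"
    unfolding C_def by (rule continuous_on_closed_Collect_le[OF cont continuous_on_const closed_atLeastAtMost])
  moreover have "{a..b} \<inter> C = C" by (auto simp: C_def)
  ultimately have "compact C"
    using compact_Int_closed[OF compact_Icc[of a b], of C] by simp
  moreover have "a \<in> C" using assms by (auto simp: C_def)
  ultimately obtain c where c: "c \<in> C" "\<And>t. t \<in> C \<Longrightarrow> t \<le> c"
    using compact_attains_sup[of C] by blast
  have cb: "c \<in> {a..b}" "h c \<le> 0" using c by (auto simp: C_def)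
  have pos: "h t > 0" if "t \<in> {c<..b}" for t
    using c(2)[of t] that cb by (force simp: C_def)
  have "h c = 0"
  proof (rule ccontr)
    assume "h c \<noteq> 0"
    then have "h c \<le> 0" "0 \<le> h b" using cb \<open>\<not> h b \<le> 0\<close> by auto
    then obtain t where "c \<le> t" "t \<le> b" "h t = 0"
      using IVT'[of h c 0 b] cb continuous_on_subset[OF cont, of "{c..b}"] by auto
    then show False using pos[of t] \<open>h c \<noteq> 0\<close> by (cases "t = c") auto
  qed
  have "h b \<le> h c"
  proof (rule abs_continuous_on_nonincreasing[where f = h and a = c and b = b, OF _ _ S])
    show "abs_continuous_on {c..b} h" using abs_continuous_on_subset[OF ac] cb by auto
    fix t assume t: "t \<in> {c..b}" "t \<notin> S"
    then have "h t \<ge> 0" using pos[of t] \<open>h c = 0\<close> by (cases "t = c") auto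
    then obtain D where "(h has_real_derivative D) (at t within {a..b})" "D \<le> 0"
      using h'[of t] t cb by auto
    then show "\<exists>D\<le>0. (h has_real_derivative D) (at t within {c..b})"
      using cb DERIV_subset[of h D t "{a..b}" "{c..b}"] by auto
  qed (use cb in auto)
  then show False using \<open>\<not> h b \<le> 0\<close> \<open>h c = 0\<close> by simp
qed

section \<open>Barriers for the norm of a vector-valued function\<close>

lemma abs_continuous_on_bounded_derivative:
  fixes g :: "real \<Rightarrow> real"
  assumes "\<And>t. t \<in> {a..b} \<Longrightarrow> (g has_real_derivative g' t) (at t within {a..b})"
    and "\<And>t. t \<in> {a..b} \<Longrightarrow> \<bar>g' t\<bar> \<le> C"
  shows "abs_continuous_on {a..b} g"
proof (rule abs_continuous_on_lipschitz[of "\<bar>C\<bar> + 1"])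
  fix s t assume "s \<in> {a..b}" "t \<in> {a..b}"
  then have "norm (g t - g s) \<le> C * norm (t - s)"
    using assms by (intro field_differentiable_bound[of "{a..b}" g g']) auto
  also have "\<dots> \<le> (\<bar>C\<bar> + 1) * norm (t - s)" by (intro mult_right_mono) auto
  finally show "\<bar>g t - g s\<bar> \<le> (\<bar>C\<bar> + 1) * \<bar>t - s\<bar>" by simp
qed auto

lemma inner_le_norm_of_unit: "norm w \<le> 1 \<Longrightarrow> w \<bullet> z \<le> norm z" for w z :: "'a::real_inner"
  using norm_cauchy_schwarz[of w z] mult_right_mono[of "norm w" 1 "norm z"] by simp

lemma unit_attaining_norm:
  fixes z :: "'a::real_inner"
  obtains w where "norm w \<le> 1" "w \<bullet> z = norm z"
proof (rule that[of "sgn z"])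
  show "norm (sgn z) \<le> 1" by (simp add: norm_sgn)
  show "sgn z \<bullet> z = norm z"
    by (cases "z = 0") (auto simp: sgn_div_norm dot_square_norm power2_eq_square)
qed

lemma norm_leI_inner:
  fixes z :: "'a::real_inner"
  assumes "\<And>w. norm w \<le> 1 \<Longrightarrow> w \<bullet> z \<le> m"
  shows "norm z \<le> m"
  using unit_attaining_norm[of z] assms by metis

text \<open>The norm is not differentiable at the origin, and a maximum of norms is not differentiable where
  the maximiser switches. Both difficulties vanish if \<open>y\<close> is tested against the single unit vector
  \<open>w\<close> that attains the norm of \<open>y T\<close> at the final time: \<open>w \<bullet> y\<close> is as smooth as \<open>y\<close>, it never
  exceeds the norm, and it equals the norm at \<open>T\<close>. The term with the factor \<open>K\<close> is a restoring
  force. It has the right sign exactly when \<open>w \<bullet> y\<close> lies above the barrier \<open>g\<close>, which is the only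
  situation where a bound is needed.\<close>

lemma norm_le_barrier:
  fixes y :: "real \<Rightarrow> 'a::real_inner" and g g' :: "real \<Rightarrow> real"
  assumes "s \<le> T" and ac: "abs_continuous_on {s..T} y"
    and g: "\<And>t. t \<in> {s..T} \<Longrightarrow> (g has_real_derivative g' t) (at t within {s..T})"
      "\<And>t. t \<in> {s..T} \<Longrightarrow> \<bar>g' t\<bar> \<le> C"
    and "K \<ge> 0"
    and ae: "AE t in lebesgue. t \<in> {s..T} \<longrightarrow>
      (\<exists>v. (y has_vector_derivative v) (at t within {s..T}) \<and>
           (\<forall>w. norm w \<le> 1 \<longrightarrow> w \<bullet> v \<le> g' t + K * (g t - w \<bullet> y t)))"
    and start: "norm (y s) \<le> g s"
  shows "norm (y T) \<le> g T"
proof -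
  obtain w where w: "norm w \<le> 1" "w \<bullet> y T = norm (y T)" by (rule unit_attaining_norm)
  note wle = inner_le_norm_of_unit[OF w(1)]
  define h where "h t = w \<bullet> y t - g t" for t
  let ?Q = "\<lambda>t. t \<in> {s..T} \<longrightarrow>
      (\<exists>v. (y has_vector_derivative v) (at t within {s..T}) \<and>
           (\<forall>w. norm w \<le> 1 \<longrightarrow> w \<bullet> v \<le> g' t + K * (g t - w \<bullet> y t)))"
  from ae obtain S where "S \<in> null_sets lebesgue" and Q: "{t \<in> space lebesgue. \<not> ?Q t} \<subseteq> S"
    unfolding eventually_ae_filter by blast
  then have S: "negligible S" by (simp add: negligible_iff_null_sets)
  have "space lebesgue = UNIV" by simp
  then have Q: "?Q t" if "t \<notin> S" for t using Q that by blast
  have "h T \<le> 0"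
  proof (rule abs_continuous_on_stays_nonpos[OF \<open>s \<le> T\<close> _ S])
    have "abs_continuous_on {s..T} g"
      using abs_continuous_on_bounded_derivative[OF g] .
    then show "abs_continuous_on {s..T} h"
    proof (rule abs_continuous_on_dominated[OF ac])
      fix a b
      have "\<bar>w \<bullet> (y b - y a)\<bar> \<le> norm (y b - y a)"
        using wle[of "y b - y a"] wle[of "- (y b - y a)"] by (simp only: inner_minus_right norm_minus_cancel)
      then show "norm (h b - h a) \<le> norm (y b - y a) + norm (g b - g a)"
        by (simp add: h_def inner_diff_right)
    qed
    show "h s \<le> 0" using start wle[of "y s"] by (simp add: h_def)
    fix t assume t: "t \<in> {s..T}" "t \<notin> S"
    then obtain v where v: "(y has_vector_derivative v) (at t within {s..T})"
      "w \<bullet> v \<le> g' t + K * (g t - w \<bullet> y t)"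
      using Q w(1) by blast
    have "((\<lambda>t. w \<bullet> y t) has_vector_derivative w \<bullet> v) (at t within {s..T})"
      using bounded_linear.has_vector_derivative[OF bounded_linear_inner_right v(1)] .
    then have "(h has_real_derivative (w \<bullet> v - g' t)) (at t within {s..T})"
      unfolding h_def using g(1)[OF t(1)]
      by (intro DERIV_diff) (auto simp: has_real_derivative_iff_has_vector_derivative)
    moreover have "h t \<ge> 0 \<longrightarrow> w \<bullet> v - g' t \<le> 0"
      using v(2) \<open>K \<ge> 0\<close> mult_nonneg_nonneg[of K "h t"] by (auto simp: h_def algebra_simps)
    ultimately show "\<exists>D. (h has_real_derivative D) (at t within {s..T}) \<and> (h t \<ge> 0 \<longrightarrow> D \<le> 0)"
      by blast
  qed
  then show ?thesis using w(2) by (simp add: h_def)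
qed

lemma norm_diff_le_speed:
  fixes y :: "real \<Rightarrow> 'a::real_inner"
  assumes "s \<le> T" and ac: "abs_continuous_on {s..T} y"
    and ae: "AE t in lebesgue. t \<in> {s..T} \<longrightarrow>
      (\<exists>v. (y has_vector_derivative v) (at t within {s..T}) \<and> norm v \<le> V)"
  shows "norm (y T - y s) \<le> V * (T - s)"
proof -
  have "norm ((\<lambda>t. y t - y s) T) \<le> (\<lambda>t. V * (t - s)) T"
  proof (rule norm_le_barrier[where K = 0 and C = "\<bar>V\<bar>" and g' = "\<lambda>_. V", OF \<open>s \<le> T\<close>])
    show "abs_continuous_on {s..T} (\<lambda>t. y t - y s)"
      by (rule abs_continuous_on_dominated[OF ac ac]) auto
    show "((\<lambda>t. V * (t - s)) has_real_derivative V) (at t within {s..T})" for t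
      by (auto intro!: derivative_eq_intros)
    show "AE t in lebesgue. t \<in> {s..T} \<longrightarrow>
      (\<exists>v. ((\<lambda>t. y t - y s) has_vector_derivative v) (at t within {s..T}) \<and>
           (\<forall>w. norm w \<le> 1 \<longrightarrow> w \<bullet> v \<le> V + 0 * (V * (t - s) - w \<bullet> (y t - y s))))"
      using ae
    proof (rule eventually_mono, intro impI)
      fix t assume "t \<in> {s..T} \<longrightarrow>
        (\<exists>v. (y has_vector_derivative v) (at t within {s..T}) \<and> norm v \<le> V)" "t \<in> {s..T}"
      then obtain v where v: "(y has_vector_derivative v) (at t within {s..T})" "norm v \<le> V" by blast
      have "((\<lambda>t. y t - y s) has_vector_derivative v) (at t within {s..T})"
        using v(1) by (auto intro!: derivative_eq_intros)
      moreover have "w \<bullet> v \<le> V" if "norm w \<le> 1" for w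
        using inner_le_norm_of_unit[OF that, of v] v(2) by simp
      ultimately show "\<exists>v. ((\<lambda>t. y t - y s) has_vector_derivative v) (at t within {s..T}) \<and>
           (\<forall>w. norm w \<le> 1 \<longrightarrow> w \<bullet> v \<le> V + 0 * (V * (t - s) - w \<bullet> (y t - y s)))" by auto
    qed
  qed auto
  then show ?thesis by simp
qed

lemma weighted_sum_le:
  fixes c y :: "'i \<Rightarrow> real"
  assumes "\<And>j. j \<in> J \<Longrightarrow> 0 \<le> c j \<and> c j \<le> k" "\<And>j. j \<in> J \<Longrightarrow> y j \<le> m" "0 \<le> m"
  shows "(\<Sum>j\<in>J. c j * y j) \<le> real (card J) * (k * m)"
proof (rule sum_bounded_above)
  fix j assume j: "j \<in> J"
  have "c j * y j \<le> c j * m" using assms j by (intro mult_left_mono) auto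
  also have "\<dots> \<le> k * m" using assms j by (intro mult_right_mono) auto
  finally show "c j * y j \<le> k * m" .
qed

section \<open>The delayed system and its control\<close>

locale delayed_leader_following =
  fixes N :: nat and \<gamma> M tb L R :: real and \<tau> a \<phi> :: "real \<Rightarrow> real"
    and x_init x :: "nat \<Rightarrow> real \<Rightarrow> real ^ 'd" and p :: "real \<Rightarrow> nat"
  assumes N: "N \<ge> 1" and gamma: "\<gamma> > 0" and M: "M > 0" and tb: "tb > 0"
    and delay: "\<And>t. t \<ge> 0 \<Longrightarrow> 0 \<le> \<tau> t \<and> \<tau> t \<le> tb"
    and a_bounds: "\<And>s. s \<ge> 0 \<Longrightarrow> 0 \<le> a s \<and> a s \<le> 1"
    and phi_anti: "antimono_on {0..} \<phi>" and phi_lip: "L-lipschitz_on {0..} \<phi>"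
    and phi_pos: "\<And>s. s \<ge> 0 \<Longrightarrow> \<phi> s > 0" and phi_0: "\<phi> 0 = 1"
    and sel: "farthest_selection N x p"
    and sol: "solves_P N \<gamma> tb \<tau> a \<phi> x_init (feedback_control N \<gamma> M \<tau> \<phi> x p) x"
    and R: "R = initial_radius N tb x"
begin

abbreviation control :: "real \<Rightarrow> real ^ 'd" where
  "control \<equiv> feedback_control N \<gamma> M \<tau> \<phi> x p"

text \<open>The value of \<open>\<phi>\<close> that limits the gain of the control: it belongs to the agent that is currently
  farthest from the leader.\<close>

abbreviation farthest_weight :: "real \<Rightarrow> real" where
  "farthest_weight t \<equiv> \<phi> (norm (x (p t) (t - \<tau> t) - x 0 t))"

definition velocity :: "nat \<Rightarrow> real \<Rightarrow> real ^ 'd" where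
  "velocity i t = (if i = 0 then control t else agent_rhs N \<gamma> \<tau> a \<phi> x i t)"

lemma L_nonneg: "L \<ge> 0"
  using phi_lip by (auto simp: lipschitz_on_def)

lemma phi_le: "0 \<le> s \<Longrightarrow> s \<le> t \<Longrightarrow> \<phi> t \<le> \<phi> s"
  using phi_anti by (auto simp: monotone_on_def)

lemma phi_le_1: "0 \<le> s \<Longrightarrow> \<phi> s \<le> 1"
  using phi_le[of 0 s] phi_0 by simp

lemma delayed_time: "t \<ge> 0 \<Longrightarrow> t - \<tau> t \<in> {-tb..t}" "t \<ge> 0 \<Longrightarrow> t - \<tau> t \<in> {t - tb..t}"
  using delay[of t] by auto

lemma continuous_x: "i \<in> {0..N} \<Longrightarrow> continuous_on {-tb..} (x i)"
  using sol by (auto simp: solves_P_def)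

lemma abs_continuous_x:
  assumes "i \<in> {0..N}" "s \<ge> 0"
  shows "abs_continuous_on {s..T} (x i)"
proof -
  have "abs_continuous_on {0..\<bar>T\<bar> + 1} (x i)"
    using sol assms(1) by (auto simp: solves_P_def locally_abs_continuous_halfline_def)
  then show ?thesis by (rule abs_continuous_on_subset) (use assms in auto)
qed

lemma velocity_derivative:
  assumes "s \<ge> 0"
  shows "AE t in lebesgue. t \<in> {s..T} \<longrightarrow>
     (\<forall>i\<in>{0..N}. (x i has_vector_derivative velocity i t) (at t within {s..T}))"
proof -
  have "AE t in lebesgue. \<forall>i\<in>{0..N}. t \<ge> 0 \<longrightarrow>
      (x i has_vector_derivative velocity i t) (at t within {0..})"
  proof (rule AE_finite_allI)
    fix i assume "i \<in> {0..N}"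
    then show "AE t in lebesgue. t \<ge> 0 \<longrightarrow>
        (x i has_vector_derivative velocity i t) (at t within {0..})"
      using sol by (cases "i = 0") (auto simp: solves_P_def velocity_def)
  qed simp
  then show ?thesis
    by eventually_elim (use assms in \<open>force intro: has_vector_derivative_within_subset[of _ _ _ "{0..}"]\<close>)
qed

lemma exp_rate_le_1: "t \<ge> 0 \<Longrightarrow> exp (- (1 + \<gamma>) * t) \<le> 1"
  using gamma unfolding exp_le_one_iff by (intro mult_nonpos_nonneg) auto

lemma trajectories_bounded:
  obtains B where "\<And>i s. i \<in> {0..N} \<Longrightarrow> s \<in> {-tb..T} \<Longrightarrow> norm (x i s) \<le> B"
proof -
  have "continuous_on {-tb..T} (\<lambda>s. \<Sum>i=0..N. norm (x i s))"
    by (intro continuous_intros continuous_on_subset[OF continuous_x]) auto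
  then have "compact ((\<lambda>s. \<Sum>i=0..N. norm (x i s)) ` {-tb..T})"
    by (intro compact_continuous_image) auto
  then obtain B where B: "\<And>s. s \<in> {-tb..T} \<Longrightarrow> (\<Sum>i=0..N. norm (x i s)) \<le> B"
    using bounded_imp_bdd_above[OF compact_imp_bounded] by (force simp: bdd_above_def)
  show thesis
  proof (rule that)
    fix i s assume "i \<in> {0..N}" "s \<in> {-tb..T}"
    then show "norm (x i s) \<le> B"
      using B[of s] member_le_sum[of i "{0..N}" "\<lambda>i. norm (x i s)"] by auto
  qed
qed

lemma initial_bound:
  assumes i: "i \<in> {0..N}" and s: "s \<in> {-tb..0}"
  shows "norm (x i s) \<le> R"
proof -
  obtain B where B: "\<And>i s. i \<in> {0..N} \<Longrightarrow> s \<in> {-tb..0} \<Longrightarrow> norm (x i s) \<le> B"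
    using trajectories_bounded[of 0] by blast
  have "Max ((\<lambda>i. norm (x i s)) ` {0..N}) \<le> B" if "s \<in> {-tb..0}" for s
    using B that by (intro Max.boundedI) auto
  then have "Max ((\<lambda>i. norm (x i s)) ` {0..N}) \<le> R"
    unfolding R initial_radius_def by (intro cSUP_upper s bdd_aboveI2) auto
  moreover have "norm (x i s) \<le> Max ((\<lambda>i. norm (x i s)) ` {0..N})"
    using i by (intro Max_ge) auto
  ultimately show ?thesis by linarith
qed

lemma R_nonneg: "R \<ge> 0"
  using order_trans[OF norm_ge_zero initial_bound[of 0 0]] tb by simp

lemma leader_dist_ge: "i \<in> {1..N} \<Longrightarrow> norm (x i t - x 0 t) \<le> leader_dist N x t"
  unfolding leader_dist_def by (intro Max_ge) auto

lemma leader_dist_le: "(\<And>i. i \<in> {1..N} \<Longrightarrow> norm (x i t - x 0 t) \<le> m) \<Longrightarrow> leader_dist N x t \<le> m"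
  unfolding leader_dist_def using N by (intro Max.boundedI) auto

lemma leader_dist_nonneg: "leader_dist N x t \<ge> 0"
  using order_trans[OF norm_ge_zero leader_dist_ge[of 1 t]] N by simp

lemma control_gain_bounds:
  assumes "t \<ge> 0"
  shows "0 \<le> control_gain N \<gamma> M \<tau> \<phi> x p t"
    and "control_gain N \<gamma> M \<tau> \<phi> x p t \<le> farthest_weight t / (2 * real N)"
proof -
  define q D where "q = farthest_weight t / real N"
    and "D = \<gamma> * (\<Sum>j=1..N. norm (x j (t - \<tau> t) - x 0 t))"
  have "q \<ge> 0" using phi_pos[of "norm (x (p t) (t - \<tau> t) - x 0 t)"] by (simp add: q_def)
  moreover have "D \<ge> 0" using gamma by (auto simp: D_def intro!: mult_nonneg_nonneg sum_nonneg)
  moreover have *: "control_gain N \<gamma> M \<tau> \<phi> x p t = 1 / 2 * (if D = 0 then q else min q (2 * M / D))"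
    by (simp add: control_gain_def q_def D_def Let_def)
  ultimately show "0 \<le> control_gain N \<gamma> M \<tau> \<phi> x p t" unfolding * using M by auto
  have "control_gain N \<gamma> M \<tau> \<phi> x p t \<le> 1 / 2 * q" unfolding * by auto
  then show "control_gain N \<gamma> M \<tau> \<phi> x p t \<le> farthest_weight t / (2 * real N)"
    by (simp add: q_def)
qed

text \<open>The gain is at most half the farthest weight divided by \<open>N\<close>, so the control is at most \<open>\<gamma> / 2\<close>
  times that weight times an average over the agents. The factor one half is what later leaves half
  of the attraction towards the leader uncompensated.\<close>

lemma inner_control_le:
  assumes "t \<ge> 0" and m: "\<And>j. j \<in> {1..N} \<Longrightarrow> w \<bullet> (x j (t - \<tau> t) - x 0 t) \<le> m" "0 \<le> m"
  shows "w \<bullet> control t \<le> \<gamma> / 2 * farthest_weight t * m"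
proof -
  let ?al = "control_gain N \<gamma> M \<tau> \<phi> x p t"
  have "(\<Sum>j=1..N. \<phi> (norm (x j (t - \<tau> t) - x 0 t)) * (w \<bullet> (x j (t - \<tau> t) - x 0 t)))
      \<le> real (card {1..N}) * (1 * m)"
    using m phi_pos phi_le_1 by (intro weighted_sum_le) (auto intro: less_imp_le)
  then have "w \<bullet> control t \<le> (\<gamma> * ?al) * (real N * m)"
    unfolding feedback_control_def using control_gain_bounds(1)[OF \<open>t \<ge> 0\<close>] gamma
    by (auto simp: inner_sum_right intro!: mult_left_mono)
  also have "\<dots> \<le> (\<gamma> * (farthest_weight t / (2 * real N))) * (real N * m)"
    using control_gain_bounds(2)[OF \<open>t \<ge> 0\<close>] gamma m(2) by (intro mult_right_mono mult_left_mono) auto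
  also have "\<dots> = \<gamma> / 2 * farthest_weight t * m" using N by (simp add: field_simps)
  finally show ?thesis .
qed

text \<open>The alignment weights sum to at most one, so the alignment term is bounded by any common
  nonnegative upper bound of its summands; the attraction by the leader is kept unchanged.\<close>

lemma inner_agent_rhs_le:
  assumes "t \<ge> 0" and i: "i \<in> {1..N}"
    and m: "\<And>j. j \<in> {1..N} \<Longrightarrow> w \<bullet> (x j (t - \<tau> t) - x i t) \<le> m" "0 \<le> m"
  shows "w \<bullet> agent_rhs N \<gamma> \<tau> a \<phi> x i t
    \<le> m + \<gamma> * \<phi> (norm (x 0 (t - \<tau> t) - x i t)) * (w \<bullet> (x 0 (t - \<tau> t) - x i t))"
proof -
  have "(\<Sum>j\<in>{1..N} - {i}. a (norm (x j (t - \<tau> t) - x i t)) * (w \<bullet> (x j (t - \<tau> t) - x i t)))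
      \<le> real (card ({1..N} - {i})) * (1 * m)"
    using m a_bounds by (intro weighted_sum_le) auto
  also have "\<dots> \<le> real N * m"
    using i m(2) by (auto intro!: mult_right_mono)
  finally have "1 / real N * (\<Sum>j\<in>{1..N} - {i}. a (norm (x j (t - \<tau> t) - x i t)) * (w \<bullet> (x j (t - \<tau> t) - x i t))) \<le> m"
    using N by (simp add: field_simps)
  then show ?thesis by (simp add: agent_rhs_def inner_add_right inner_sum_right)
qed

section \<open>The ball of initial radius is invariant\<close>

text \<open>Both the agents and the leader are pulled, with total rate at most \<open>1 + \<gamma>\<close>, towards delayed
  positions that lie in the ball of radius \<open>Z\<close>.\<close>

lemma inner_velocity_le:
  assumes "t \<ge> 0" and i: "i \<in> {0..N}" and "norm w \<le> 1"
    and Z: "\<And>j s. j \<in> {0..N} \<Longrightarrow> s \<in> {-tb..t} \<Longrightarrow> norm (x j s) \<le> Z"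
  shows "w \<bullet> velocity i t \<le> (1 + \<gamma>) * (Z - w \<bullet> x i t)"
proof -
  define m where "m = Z - w \<bullet> x i t"
  have le: "w \<bullet> (x j (t - \<tau> t) - x i t) \<le> m" if "j \<in> {0..N}" for j
    using inner_le_norm_of_unit[OF \<open>norm w \<le> 1\<close>, of "x j (t - \<tau> t)"]
      Z[OF that delayed_time(1)[OF \<open>t \<ge> 0\<close>]] by (simp add: m_def inner_diff_right)
  have "m \<ge> 0"
    using inner_le_norm_of_unit[OF \<open>norm w \<le> 1\<close>, of "x i t"] Z[OF i, of t] tb \<open>t \<ge> 0\<close>
    by (simp add: m_def)
  show ?thesis
  proof (cases "i = 0")
    case True
    have "w \<bullet> control t \<le> \<gamma> / 2 * farthest_weight t * m"
      using le \<open>m \<ge> 0\<close> True by (intro inner_control_le \<open>t \<ge> 0\<close>) auto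
    also have "\<dots> \<le> (1 + \<gamma>) * m"
    proof -
      have "\<gamma> / 2 * farthest_weight t \<le> \<gamma> / 2 * 1"
        using gamma phi_le_1 by (intro mult_left_mono) auto
      then have "\<gamma> / 2 * farthest_weight t \<le> 1 + \<gamma>" using gamma by linarith
      then show ?thesis using \<open>m \<ge> 0\<close> by (rule mult_right_mono)
    qed
    finally show ?thesis using True by (simp add: velocity_def m_def)
  next
    case False
    define f where "f = \<phi> (norm (x 0 (t - \<tau> t) - x i t))"
    have f: "0 < f" "f \<le> 1" using phi_pos phi_le_1 by (auto simp: f_def)
    have "w \<bullet> agent_rhs N \<gamma> \<tau> a \<phi> x i t \<le> m + \<gamma> * f * (w \<bullet> (x 0 (t - \<tau> t) - x i t))"
      unfolding f_def using le \<open>m \<ge> 0\<close> i False by (intro inner_agent_rhs_le \<open>t \<ge> 0\<close>) auto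
    also have "\<gamma> * f * (w \<bullet> (x 0 (t - \<tau> t) - x i t)) \<le> \<gamma> * f * m"
      using f gamma le[of 0] by (intro mult_left_mono) auto
    also have "\<gamma> * f * m \<le> \<gamma> * 1 * m"
      using f gamma \<open>m \<ge> 0\<close> by (intro mult_right_mono mult_left_mono) auto
    finally show ?thesis using False by (simp add: velocity_def m_def algebra_simps)
  qed
qed

text \<open>Any a priori bound \<open>Z\<close> on a finite time interval improves itself: starting from radius \<open>R\<close>, the
  distance to the sphere of radius \<open>Z\<close> can shrink only at the rate \<open>1 + \<gamma>\<close>, so at time \<open>T\<close> a
  definite fraction of the gap \<open>Z - R\<close> is left unused.\<close>

lemma bound_contracts:
  assumes "T \<ge> 0" "R \<le> Z" and Z: "\<And>j s. j \<in> {0..N} \<Longrightarrow> s \<in> {-tb..T} \<Longrightarrow> norm (x j s) \<le> Z"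
    and i: "i \<in> {0..N}" and s: "s \<in> {-tb..T}"
  shows "norm (x i s) \<le> R + (1 - exp (- (1 + \<gamma>) * T)) * (Z - R)"
proof (cases "s \<le> 0")
  case True
  then have "norm (x i s) \<le> R" using initial_bound[OF i, of s] s by auto
  moreover have "0 \<le> (1 - exp (- (1 + \<gamma>) * T)) * (Z - R)"
    using assms(2) exp_rate_le_1[OF \<open>T \<ge> 0\<close>] by (intro mult_nonneg_nonneg) auto
  ultimately show ?thesis by linarith
next
  case False
  \<comment> \<open>The solution of \<open>g' = (1 + \<gamma>) * (Z - g)\<close> with \<open>g 0 = R\<close>.\<close>
  define g where "g t = Z - exp (- (1 + \<gamma>) * t) * (Z - R)" for t
  have "norm (x i s) \<le> g s"
  proof (rule norm_le_barrier[where y = "x i" and g = g and s = 0 and T = s and K = "1 + \<gamma>"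
        and C = "(1 + \<gamma>) * (Z - R)"
        and g' = "\<lambda>t. (1 + \<gamma>) * exp (- (1 + \<gamma>) * t) * (Z - R)"])
    show "abs_continuous_on {0..s} (x i)" using abs_continuous_x[OF i] by simp
    show "(g has_real_derivative (1 + \<gamma>) * exp (- (1 + \<gamma>) * t) * (Z - R)) (at t within {0..s})" for t
      unfolding g_def by (auto intro!: derivative_eq_intros simp: algebra_simps)
    show "\<bar>(1 + \<gamma>) * exp (- (1 + \<gamma>) * t) * (Z - R)\<bar> \<le> (1 + \<gamma>) * (Z - R)" if "t \<in> {0..s}" for t
    proof -
      have "(1 + \<gamma>) * exp (- (1 + \<gamma>) * t) * (Z - R) \<le> (1 + \<gamma>) * 1 * (Z - R)"
        using gamma \<open>R \<le> Z\<close> that by (intro mult_right_mono mult_left_mono exp_rate_le_1) auto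
      then show ?thesis using gamma \<open>R \<le> Z\<close> by (simp add: abs_mult)
    qed
    show "AE t in lebesgue. t \<in> {0..s} \<longrightarrow> (\<exists>v. (x i has_vector_derivative v) (at t within {0..s}) \<and>
        (\<forall>w. norm w \<le> 1 \<longrightarrow> w \<bullet> v \<le> (1 + \<gamma>) * exp (- (1 + \<gamma>) * t) * (Z - R) + (1 + \<gamma>) * (g t - w \<bullet> x i t)))"
      using velocity_derivative[OF order_refl]
    proof (rule eventually_mono, intro impI exI conjI allI)
      fix t assume der: "t \<in> {0..s} \<longrightarrow>
          (\<forall>i\<in>{0..N}. (x i has_vector_derivative velocity i t) (at t within {0..s}))" and t: "t \<in> {0..s}"
      then show "(x i has_vector_derivative velocity i t) (at t within {0..s})" using i by blast
      fix w :: "real ^ 'd" assume "norm w \<le> 1"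
      then have "w \<bullet> velocity i t \<le> (1 + \<gamma>) * (Z - w \<bullet> x i t)"
        using t s i Z by (intro inner_velocity_le) auto
      then show "w \<bullet> velocity i t \<le> (1 + \<gamma>) * exp (- (1 + \<gamma>) * t) * (Z - R) + (1 + \<gamma>) * (g t - w \<bullet> x i t)"
        by (simp add: g_def algebra_simps)
    qed
    show "norm (x i 0) \<le> g 0" using initial_bound[OF i, of 0] tb by (simp add: g_def)
  qed (use False gamma in auto)
  also have "g s \<le> Z - exp (- (1 + \<gamma>) * T) * (Z - R)"
    unfolding g_def using \<open>R \<le> Z\<close> s gamma by (intro diff_left_mono mult_right_mono) auto
  finally show ?thesis by (simp add: algebra_simps)
qed

text \<open>Compactness gives some bound on each finite time interval, and iterating the self-improvement
  contracts it geometrically to \<open>R\<close>.\<close>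

lemma bounded_by_initial_radius:
  assumes i: "i \<in> {0..N}" and s: "s \<ge> -tb"
  shows "norm (x i s) \<le> R"
proof -
  define T where "T = max s 0"
  define k where "k = 1 - exp (- (1 + \<gamma>) * T)"
  have k: "0 \<le> k" "k < 1" using exp_rate_le_1[of T] by (auto simp: k_def T_def)
  obtain B where B: "\<And>i s. i \<in> {0..N} \<Longrightarrow> s \<in> {-tb..T} \<Longrightarrow> norm (x i s) \<le> B"
    using trajectories_bounded[of T] by blast
  define Z where "Z = max B R"
  have "\<forall>j\<in>{0..N}. \<forall>s\<in>{-tb..T}. norm (x j s) \<le> R + k ^ n * (Z - R)" for n
  proof (induction n)
    case 0
    show ?case using B by (auto simp: Z_def le_max_iff_disj)
  next
    case (Suc n)
    have "R \<le> R + k ^ n * (Z - R)" using k by (auto simp: Z_def)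
    then have "norm (x j s) \<le> R + k * (R + k ^ n * (Z - R) - R)" if "j \<in> {0..N}" "s \<in> {-tb..T}" for j s
      unfolding k_def using Suc that by (intro bound_contracts) (auto simp: k_def T_def)
    then show ?case by (simp add: mult.assoc)
  qed
  then have "norm (x i s) \<le> R + k ^ n * (Z - R)" for n
    using i s by (auto simp: T_def)
  moreover have "(\<lambda>n. R + k ^ n * (Z - R)) \<longlonglongrightarrow> R + 0 * (Z - R)"
    using k by (intro tendsto_intros LIMSEQ_realpow_zero) auto
  ultimately show ?thesis
    using LIMSEQ_le_const[of "\<lambda>n. R + k ^ n * (Z - R)" R "norm (x i s)"] by auto
qed

section \<open>Velocities in terms of distance and delay error\<close>

text \<open>The displacement of the leader is added to that of one agent, rather than bounding the two
  separately. When the relative velocity of an agent and the leader is estimated, both displacements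
  occur; measuring their sum keeps the total coefficient at \<open>\<gamma> * L * R + \<gamma> + 1\<close>. The whole window of
  length \<open>tb\<close> is used because the actual delay varies with time.\<close>

definition delay_spread_le :: "real \<Rightarrow> real \<Rightarrow> bool" where
  "delay_spread_le t E \<longleftrightarrow>
     (\<forall>s\<in>{t - tb..t}. \<forall>j\<in>{1..N}. norm (x 0 t - x 0 s) + norm (x j t - x j s) \<le> E)"

lemma delay_spread_le_mono: "delay_spread_le t E \<Longrightarrow> E \<le> E' \<Longrightarrow> delay_spread_le t E'"
  unfolding delay_spread_le_def by (meson order_trans)

lemma delay_spread_le_delayed:
  assumes "t \<ge> 0" "delay_spread_le t E" "j \<in> {1..N}"
  shows "norm (x 0 (t - \<tau> t) - x 0 t) + norm (x j (t - \<tau> t) - x j t) \<le> E"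
proof -
  have "norm (x 0 t - x 0 (t - \<tau> t)) + norm (x j t - x j (t - \<tau> t)) \<le> E"
    using assms delayed_time(2)[OF assms(1)] unfolding delay_spread_le_def by blast
  then show ?thesis by (simp only: norm_minus_commute)
qed

lemma norm_velocity_leader_le:
  assumes "t \<ge> 0" and E: "delay_spread_le t E"
  shows "norm (velocity 0 t) \<le> \<gamma> / 2 * (E + leader_dist N x t)"
proof (rule norm_leI_inner)
  fix w :: "real ^ 'd" assume w: "norm w \<le> 1"
  let ?m = "E + leader_dist N x t"
  have j: "w \<bullet> (x j (t - \<tau> t) - x 0 t) \<le> ?m" if "j \<in> {1..N}" for j
  proof -
    have "w \<bullet> (x j (t - \<tau> t) - x 0 t) \<le> norm ((x j (t - \<tau> t) - x j t) + (x j t - x 0 t))"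
      using inner_le_norm_of_unit[OF w] by simp
    also have "\<dots> \<le> ?m"
      using norm_triangle_ineq[of "x j (t - \<tau> t) - x j t" "x j t - x 0 t"] leader_dist_ge[OF that, of t]
        delay_spread_le_delayed[OF assms that] norm_ge_zero[of "x 0 (t - \<tau> t) - x 0 t"] by linarith
    finally show ?thesis .
  qed
  have E0: "E \<ge> 0"
    using order_trans[OF _ delay_spread_le_delayed[OF assms, of 1]] N by simp
  then have "0 \<le> ?m" using leader_dist_nonneg by (intro add_nonneg_nonneg)
  have "w \<bullet> control t \<le> \<gamma> / 2 * farthest_weight t * ?m"
    using inner_control_le[OF \<open>t \<ge> 0\<close> j \<open>0 \<le> ?m\<close>] .
  also have "\<dots> \<le> \<gamma> / 2 * 1 * ?m"
    using gamma phi_le_1 \<open>0 \<le> ?m\<close> by (intro mult_right_mono mult_left_mono) auto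
  finally show "w \<bullet> velocity 0 t \<le> \<gamma> / 2 * ?m" by (simp add: velocity_def)
qed

lemma norm_velocity_agent_le:
  assumes "t \<ge> 0" and E: "delay_spread_le t E" and i: "i \<in> {1..N}"
  shows "norm (velocity i t) \<le> (1 + \<gamma>) * E + (2 + \<gamma>) * leader_dist N x t"
proof (rule norm_leI_inner)
  fix w :: "real ^ 'd" assume w: "norm w \<le> 1"
  let ?d = "leader_dist N x t"
  have j: "w \<bullet> (x j (t - \<tau> t) - x i t) \<le> E + 2 * ?d" if "j \<in> {1..N}" for j
  proof -
    have "w \<bullet> (x j (t - \<tau> t) - x i t) \<le> norm ((x j (t - \<tau> t) - x j t) + (x j t - x 0 t) - (x i t - x 0 t))"
      using inner_le_norm_of_unit[OF w] by simp
    also have "\<dots> \<le> E + 2 * ?d"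
      using norm_triangle_ineq[of "x j (t - \<tau> t) - x j t" "x j t - x 0 t"]
        norm_triangle_ineq4[of "(x j (t - \<tau> t) - x j t) + (x j t - x 0 t)" "x i t - x 0 t"]
        leader_dist_ge[OF that, of t] leader_dist_ge[OF i, of t]
        delay_spread_le_delayed[OF assms(1,2) that] norm_ge_zero[of "x 0 (t - \<tau> t) - x 0 t"] by linarith
    finally show ?thesis .
  qed
  have E0: "E \<ge> 0"
    using order_trans[OF _ delay_spread_le_delayed[OF assms(1,2), of 1]] N by simp
  have d0: "?d \<ge> 0" by (rule leader_dist_nonneg)
  define f where "f = \<phi> (norm (x 0 (t - \<tau> t) - x i t))"
  have f: "0 < f" "f \<le> 1" using phi_pos phi_le_1 by (auto simp: f_def)
  have "w \<bullet> (x 0 (t - \<tau> t) - x i t) \<le> norm ((x 0 (t - \<tau> t) - x 0 t) - (x i t - x 0 t))"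
    using inner_le_norm_of_unit[OF w] by simp
  also have "\<dots> \<le> E + ?d"
    using norm_triangle_ineq4[of "x 0 (t - \<tau> t) - x 0 t" "x i t - x 0 t"] leader_dist_ge[OF i, of t]
      delay_spread_le_delayed[OF assms] norm_ge_zero[of "x i (t - \<tau> t) - x i t"] by linarith
  finally have "\<gamma> * f * (w \<bullet> (x 0 (t - \<tau> t) - x i t)) \<le> \<gamma> * f * (E + ?d)"
    using gamma f by (intro mult_left_mono) auto
  also have "\<dots> \<le> \<gamma> * 1 * (E + ?d)"
    using gamma f E0 d0 by (intro mult_right_mono mult_left_mono) auto
  finally have "w \<bullet> agent_rhs N \<gamma> \<tau> a \<phi> x i t \<le> E + 2 * ?d + \<gamma> * (E + ?d)"
    using inner_agent_rhs_le[OF \<open>t \<ge> 0\<close> i j] E0 d0 by (fastforce simp: f_def)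
  then show "w \<bullet> velocity i t \<le> (1 + \<gamma>) * E + (2 + \<gamma>) * ?d"
    using i by (simp add: velocity_def algebra_simps)
qed

lemma leader_dist_le_2R:
  assumes "t \<ge> -tb"
  shows "leader_dist N x t \<le> 2 * R"
proof (rule leader_dist_le)
  fix i assume "i \<in> {1..N}"
  then have "norm (x i t) \<le> R" "norm (x 0 t) \<le> R"
    using assms by (auto intro: bounded_by_initial_radius)
  then show "norm (x i t - x 0 t) \<le> 2 * R" using norm_triangle_ineq4[of "x i t" "x 0 t"] by linarith
qed

text \<open>The control is limited by the weight of the farthest agent, whereas agent \<open>i\<close> is attracted with
  its own weight; the two have to be compared for every \<open>i\<close>. Without delay the farthest agent has
  the smallest weight, because \<open>\<phi>\<close> is non-increasing. With delay the two distances may be in the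
  wrong order, but by no more than \<open>E\<close>, and the Lipschitz constant of \<open>\<phi>\<close> absorbs this.\<close>

lemma farthest_weight_le:
  assumes "t \<ge> 0" and E: "delay_spread_le t E" and i: "i \<in> {1..N}"
  shows "farthest_weight t \<le> \<phi> (norm (x 0 (t - \<tau> t) - x i t)) + L * E"
proof -
  let ?s = "t - \<tau> t"
  define u v where "u = norm (x (p t) ?s - x 0 t)" and "v = norm (x 0 ?s - x i t)"
  have p: "p t \<in> {1..N}" "norm (x (p t) t - x 0 t) = leader_dist N x t"
    using sel \<open>t \<ge> 0\<close> by (auto simp: farthest_selection_def)
  have E_p: "norm (x 0 ?s - x 0 t) + norm (x (p t) ?s - x (p t) t) \<le> E"
    by (rule delay_spread_le_delayed[OF assms(1,2) p(1)])
  have E0: "E \<ge> 0" by (rule order_trans[OF _ E_p]) simp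
  have "v \<le> norm (x 0 ?s - x 0 t) + norm (x i t - x 0 t)"
    using norm_triangle_ineq4[of "x 0 ?s - x 0 t" "x i t - x 0 t"] by (simp add: v_def)
  also have "\<dots> \<le> norm (x 0 ?s - x 0 t) + norm (x (p t) t - x 0 t)"
    using leader_dist_ge[OF i, of t] p(2) by simp
  also have "norm (x (p t) t - x 0 t) \<le> u + norm (x (p t) ?s - x (p t) t)"
    using norm_triangle_ineq4[of "x (p t) ?s - x 0 t" "x (p t) ?s - x (p t) t"] by (simp add: u_def)
  finally have vu: "v \<le> u + E" using E_p by linarith
  have uv: "0 \<le> u" "0 \<le> v" by (auto simp: u_def v_def)
  have "\<phi> u \<le> \<phi> v + L * E"
  proof (cases "v \<le> u")
    case True
    then show ?thesis using phi_le[OF uv(2) True] mult_nonneg_nonneg[OF L_nonneg E0] by linarith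
  next
    case False
    then have "\<phi> u - \<phi> v \<le> L * (v - u)"
      using lipschitz_onD[OF phi_lip, of u v] uv by (simp add: dist_real_def)
    also have "\<dots> \<le> L * E" using vu L_nonneg by (intro mult_left_mono) auto
    finally show ?thesis by simp
  qed
  then show ?thesis by (simp add: u_def v_def)
qed

text \<open>Write \<open>d\<close> for the largest distance to the leader and \<open>z\<close> for \<open>w \<bullet> (x i t - x 0 t)\<close>. Without
  delay, alignment contributes at most \<open>d - z\<close>, the attraction by the leader
  \<open>- \<gamma> * f * z \<le> \<gamma> * (d - z) - \<gamma> * f * d\<close>, and the control at most \<open>\<gamma> / 2 * f * d\<close>, where \<open>f\<close> is the
  weight of agent \<open>i\<close>. Half of the attraction survives, and \<open>f \<ge> \<phi> (2 * R)\<close> since nobody leaves the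
  ball of radius \<open>R\<close>. Everything else is a multiple of the delay error \<open>E\<close>. Bounding
  through \<open>d - z\<close> makes the estimate valid for all agents in all directions, not just for the
  farthest agent in its own direction.\<close>

lemma inner_relative_velocity_le:
  assumes "t \<ge> 0" and E: "delay_spread_le t E" and i: "i \<in> {1..N}" and w: "norm w \<le> 1"
  shows "w \<bullet> (velocity i t - velocity 0 t)
    \<le> (1 + \<gamma> - \<gamma> * \<phi> (2 * R) / 2) * leader_dist N x t + (\<gamma> * L * R + \<gamma> + 1) * E
        - (1 + \<gamma>) * (w \<bullet> (x i t - x 0 t))"
proof -
  let ?s = "t - \<tau> t"
  define d e0 z where "d = leader_dist N x t" and "e0 = norm (x 0 ?s - x 0 t)"
    and "z = w \<bullet> (x i t - x 0 t)"
  define f q where "f = \<phi> (norm (x 0 ?s - x i t))" and "q = farthest_weight t"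
  note [simp] = inner_diff_right
  have d: "0 \<le> d" "d \<le> 2 * R" "z \<le> d"
    using leader_dist_nonneg leader_dist_le_2R[of t] \<open>t \<ge> 0\<close> tb leader_dist_ge[OF i, of t]
      inner_le_norm_of_unit[OF w, of "x i t - x 0 t"] by (auto simp: d_def z_def)
  have e: "norm (x j ?s - x j t) \<le> E - e0" if "j \<in> {1..N}" for j
    using delay_spread_le_delayed[OF assms(1,2) that] by (simp add: e0_def)
  have e0: "0 \<le> e0" "e0 \<le> E"
    using order_trans[OF norm_ge_zero e[OF i]] by (auto simp: e0_def)
  have f: "0 < f" "f \<le> 1" "\<phi> (2 * R) \<le> f"
  proof -
    have "norm (x 0 ?s) \<le> R" "norm (x i t) \<le> R"
      using delayed_time(1)[OF \<open>t \<ge> 0\<close>] i \<open>t \<ge> 0\<close> tb by (auto intro: bounded_by_initial_radius)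
    then show "\<phi> (2 * R) \<le> f"
      unfolding f_def using norm_triangle_ineq4[of "x 0 ?s" "x i t"] by (intro phi_le) auto
  qed (use phi_pos phi_le_1 in \<open>auto simp: f_def\<close>)
  have q: "0 < q" "q \<le> 1" "q \<le> f + L * E"
    using farthest_weight_le[OF assms(1-3)] phi_pos phi_le_1 by (auto simp: f_def q_def)
  have "w \<bullet> agent_rhs N \<gamma> \<tau> a \<phi> x i t \<le> (E - e0 + (d - z)) + \<gamma> * f * (w \<bullet> (x 0 ?s - x i t))"
    unfolding f_def
  proof (rule inner_agent_rhs_le[OF \<open>t \<ge> 0\<close> i])
    fix j assume j: "j \<in> {1..N}"
    have "w \<bullet> (x j ?s - x i t) = w \<bullet> (x j ?s - x j t) + w \<bullet> (x j t - x 0 t) - z"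
      by (simp add: z_def)
    then show "w \<bullet> (x j ?s - x i t) \<le> E - e0 + (d - z)"
      using inner_le_norm_of_unit[OF w, of "x j ?s - x j t"] e[OF j] leader_dist_ge[OF j, of t]
        inner_le_norm_of_unit[OF w, of "x j t - x 0 t"] unfolding d_def by linarith
  qed (use e0 d in auto)
  moreover have "\<gamma> * f * (w \<bullet> (x 0 ?s - x i t)) \<le> \<gamma> * e0 + \<gamma> * (d - z) - \<gamma> * f * d"
  proof -
    have "w \<bullet> (x 0 ?s - x i t) = w \<bullet> (x 0 ?s - x 0 t) - z" by (simp add: z_def)
    then have "w \<bullet> (x 0 ?s - x i t) \<le> e0 - z"
      using inner_le_norm_of_unit[OF w, of "x 0 ?s - x 0 t"] by (simp add: e0_def)
    then have "\<gamma> * f * (w \<bullet> (x 0 ?s - x i t)) \<le> \<gamma> * f * (e0 - z)"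
      using gamma f by (intro mult_left_mono) auto
    also have "\<dots> = \<gamma> * f * (e0 + (d - z)) - \<gamma> * f * d" by (simp add: algebra_simps)
    also have "\<gamma> * f * (e0 + (d - z)) \<le> \<gamma> * 1 * (e0 + (d - z))"
      using gamma f e0 d by (intro mult_right_mono mult_left_mono) auto
    finally show ?thesis by (simp add: algebra_simps)
  qed
  moreover have "- (w \<bullet> control t) \<le> \<gamma> / 2 * E + \<gamma> * L * R * E + \<gamma> / 2 * f * d - \<gamma> / 2 * e0"
  proof -
    have "(- w) \<bullet> control t \<le> \<gamma> / 2 * q * (E - e0 + d)"
      unfolding q_def
    proof (rule inner_control_le[OF \<open>t \<ge> 0\<close>])
      fix j assume j: "j \<in> {1..N}"
      have "(- w) \<bullet> (x j ?s - x 0 t) = (- w) \<bullet> (x j ?s - x j t) + (- w) \<bullet> (x j t - x 0 t)" by simp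
      then show "(- w) \<bullet> (x j ?s - x 0 t) \<le> E - e0 + d"
        using inner_le_norm_of_unit[of "- w" "x j ?s - x j t"] e[OF j] leader_dist_ge[OF j, of t] w
          inner_le_norm_of_unit[of "- w" "x j t - x 0 t"] unfolding d_def norm_minus_cancel by linarith
    qed (use e0 d in auto)
    also have "\<dots> = \<gamma> / 2 * (q * (E - e0)) + \<gamma> / 2 * (q * d)"
      by (simp only: mult.assoc distrib_left)
    also have "\<dots> \<le> \<gamma> / 2 * (1 * (E - e0)) + \<gamma> / 2 * ((f + L * E) * d)"
      using q e0 d gamma by (intro add_mono mult_left_mono mult_right_mono) auto
    also have "(f + L * E) * d \<le> f * d + L * E * (2 * R)"
      using d(2) mult_left_mono[OF d(2), of "L * E"] L_nonneg e0 by (simp add: algebra_simps)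
    finally show ?thesis using gamma by (simp add: algebra_simps add_divide_distrib diff_divide_distrib)
  qed
  moreover have "\<gamma> * \<phi> (2 * R) / 2 * d \<le> \<gamma> * f / 2 * d"
    using f gamma d by (intro mult_right_mono divide_right_mono mult_left_mono) auto
  moreover have "\<gamma> / 2 * e0 \<le> \<gamma> / 2 * E" using gamma e0 by (intro mult_left_mono) auto
  moreover have "w \<bullet> (velocity i t - velocity 0 t) = w \<bullet> agent_rhs N \<gamma> \<tau> a \<phi> x i t - w \<bullet> control t"
    using i by (simp add: velocity_def)
  ultimately show ?thesis
    using e0 unfolding d_def[symmetric] z_def[symmetric] by (simp add: algebra_simps)
qed

section \<open>Exponential decay by a contraction of the constants\<close>

text \<open>The constants \<open>A\<close> and \<open>B\<close> fix the ratio in which distance and delay error are weighed against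
  each other; the common factor \<open>Z\<close> is the quantity that is contracted.\<close>

definition decays_until :: "real \<Rightarrow> real \<Rightarrow> real \<Rightarrow> real \<Rightarrow> real \<Rightarrow> bool" where
  "decays_until \<beta> A B T Z \<longleftrightarrow> (\<forall>t\<in>{0..T}.
     leader_dist N x t \<le> Z * A * exp (- \<beta> * t) \<and> delay_spread_le t (Z * B * exp (- \<beta> * t)))"

text \<open>On a bounded time interval invariance of the ball already gives a bound of the desired form: the
  distance is at most \<open>2 * R\<close> and the delay error at most \<open>4 * R\<close>.\<close>

lemma decays_until_initially:
  assumes "\<beta> \<ge> 0" "A > 0" "B > 0" "T \<ge> 0"
  shows "decays_until \<beta> A B T (exp (\<beta> * T) * (2 * R / A + 4 * R / B + 1))"
  unfolding decays_until_def
proof (intro ballI conjI)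
  fix t assume t: "t \<in> {0..T}"
  let ?C = "2 * R / A + 4 * R / B + 1"
  have "1 \<le> exp (\<beta> * T) * exp (- \<beta> * t)"
    using t assms by (simp add: exp_add[symmetric] mult_left_mono)
  moreover have "2 * R \<le> ?C * A" "4 * R \<le> ?C * B" "0 \<le> ?C"
    using assms R_nonneg by (auto simp: field_simps)
  ultimately have *: "2 * R \<le> (exp (\<beta> * T) * exp (- \<beta> * t)) * (?C * A)"
      "4 * R \<le> (exp (\<beta> * T) * exp (- \<beta> * t)) * (?C * B)"
    using mult_mono[of 1 "exp (\<beta> * T) * exp (- \<beta> * t)" "2 * R" "?C * A"]
      mult_mono[of 1 "exp (\<beta> * T) * exp (- \<beta> * t)" "4 * R" "?C * B"] R_nonneg by simp_all
  show "leader_dist N x t \<le> exp (\<beta> * T) * ?C * A * exp (- \<beta> * t)"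
    using leader_dist_le_2R[of t] t tb *(1) by (simp add: mult.commute mult.left_commute)
  have "norm (x 0 t - x 0 s) + norm (x j t - x j s) \<le> 4 * R" if "s \<in> {t - tb..t}" "j \<in> {1..N}" for s j
  proof -
    have "norm (x 0 t) \<le> R" "norm (x 0 s) \<le> R" "norm (x j t) \<le> R" "norm (x j s) \<le> R"
      using that t tb by (auto intro: bounded_by_initial_radius)
    then show ?thesis
      using norm_triangle_ineq4[of "x 0 t" "x 0 s"] norm_triangle_ineq4[of "x j t" "x j s"] by linarith
  qed
  then have "delay_spread_le t (4 * R)" by (simp add: delay_spread_le_def)
  then show "delay_spread_le t (exp (\<beta> * T) * ?C * B * exp (- \<beta> * t))"
    by (rule delay_spread_le_mono) (use *(2) in \<open>simp add: mult.commute mult.left_commute\<close>)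
qed

text \<open>The barrier \<open>Z' * A * exp (- \<beta> * u)\<close> works because its decay costs only \<open>\<beta>\<close> out of the restoring
  rate \<open>1 + \<gamma>\<close>.\<close>

lemma leader_dist_improves:
  assumes dec: "decays_until \<beta> A B T Z" and t: "t \<in> {0..T}" and "\<beta> \<ge> 0" "A > 0"
    and Z': "leader_dist N x 0 \<le> Z' * A" "0 \<le> Z'"
    and coef: "Z * ((1 + \<gamma> - \<gamma> * \<phi> (2 * R) / 2) * A + (\<gamma> * L * R + \<gamma> + 1) * B) \<le> (1 + \<gamma> - \<beta>) * (Z' * A)"
  shows "leader_dist N x t \<le> Z' * A * exp (- \<beta> * t)"
proof (rule leader_dist_le)
  fix i assume i: "i \<in> {1..N}"
  define g where "g u = Z' * A * exp (- \<beta> * u)" for u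
  have "norm ((\<lambda>u. x i u - x 0 u) t) \<le> g t"
  proof (rule norm_le_barrier[where g = g and s = 0 and T = t and K = "1 + \<gamma>" and C = "\<beta> * (Z' * A)"
        and g' = "\<lambda>u. - \<beta> * (Z' * A * exp (- \<beta> * u))"])
    show "abs_continuous_on {0..t} (\<lambda>u. x i u - x 0 u)"
    proof (rule abs_continuous_on_dominated)
      show "abs_continuous_on {0..t} (x i)" "abs_continuous_on {0..t} (x 0)"
        using i by (auto intro: abs_continuous_x)
      show "norm (x i v - x 0 v - (x i u - x 0 u)) \<le> norm (x i v - x i u) + norm (x 0 v - x 0 u)" for u v
        using norm_triangle_ineq4[of "x i v - x i u" "x 0 v - x 0 u"] by (simp add: algebra_simps)
    qed
    show "(g has_real_derivative - \<beta> * (Z' * A * exp (- \<beta> * u))) (at u within {0..t})" for u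
      unfolding g_def by (auto intro!: derivative_eq_intros)
    show "\<bar>- \<beta> * (Z' * A * exp (- \<beta> * u))\<bar> \<le> \<beta> * (Z' * A)" if "u \<in> {0..t}" for u
    proof -
      have "Z' * A * exp (- \<beta> * u) \<le> Z' * A * 1"
        using that Z' assms by (intro mult_left_mono) auto
      then show ?thesis using Z' assms by (simp add: abs_mult mult_left_mono)
    qed
    show "AE u in lebesgue. u \<in> {0..t} \<longrightarrow>
        (\<exists>v. ((\<lambda>u. x i u - x 0 u) has_vector_derivative v) (at u within {0..t}) \<and>
        (\<forall>w. norm w \<le> 1 \<longrightarrow>
           w \<bullet> v \<le> - \<beta> * (Z' * A * exp (- \<beta> * u)) + (1 + \<gamma>) * (g u - w \<bullet> (x i u - x 0 u))))"
      using velocity_derivative[OF order_refl]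
    proof (rule eventually_mono, intro impI exI conjI allI)
      fix u assume der: "u \<in> {0..t} \<longrightarrow>
          (\<forall>i\<in>{0..N}. (x i has_vector_derivative velocity i u) (at u within {0..t}))" and u: "u \<in> {0..t}"
      have "(x i has_vector_derivative velocity i u) (at u within {0..t})"
        "(x 0 has_vector_derivative velocity 0 u) (at u within {0..t})"
        using i u der by auto
      then show "((\<lambda>u. x i u - x 0 u) has_vector_derivative velocity i u - velocity 0 u) (at u within {0..t})"
        by (rule has_vector_derivative_diff)
      fix w :: "real ^ 'd" assume w: "norm w \<le> 1"
      let ?e = "exp (- \<beta> * u)"
      have b: "leader_dist N x u \<le> Z * A * ?e" "delay_spread_le u (Z * B * ?e)"
        using dec u t by (auto simp: decays_until_def)
      have "\<phi> (2 * R) \<le> 1" using phi_le_1 R_nonneg by simp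
      then have "\<gamma> * \<phi> (2 * R) \<le> \<gamma> * 1" using gamma by (intro mult_left_mono) auto
      then have "0 \<le> 1 + \<gamma> - \<gamma> * \<phi> (2 * R) / 2" using gamma by linarith
      then have "w \<bullet> (velocity i u - velocity 0 u)
          \<le> (1 + \<gamma> - \<gamma> * \<phi> (2 * R) / 2) * (Z * A * ?e) + (\<gamma> * L * R + \<gamma> + 1) * (Z * B * ?e)
            - (1 + \<gamma>) * (w \<bullet> (x i u - x 0 u))"
        using inner_relative_velocity_le[OF _ b(2) i w] u
          mult_left_mono[OF b(1), of "1 + \<gamma> - \<gamma> * \<phi> (2 * R) / 2"] by simp
      also have "\<dots> = Z * ((1 + \<gamma> - \<gamma> * \<phi> (2 * R) / 2) * A + (\<gamma> * L * R + \<gamma> + 1) * B) * ?e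
            - (1 + \<gamma>) * (w \<bullet> (x i u - x 0 u))" by (simp add: algebra_simps)
      also have "\<dots> \<le> (1 + \<gamma> - \<beta>) * (Z' * A) * ?e - (1 + \<gamma>) * (w \<bullet> (x i u - x 0 u))"
        by (intro diff_right_mono mult_right_mono coef) auto
      finally show "w \<bullet> (velocity i u - velocity 0 u)
          \<le> - \<beta> * (Z' * A * ?e) + (1 + \<gamma>) * (g u - w \<bullet> (x i u - x 0 u))"
        by (simp add: g_def algebra_simps)
    qed
    show "norm (x i 0 - x 0 0) \<le> g 0"
      using leader_dist_ge[OF i, of 0] Z'(1) by (simp add: g_def)
  qed (use t gamma in auto)
  then show "norm (x i t - x 0 t) \<le> Z' * A * exp (- \<beta> * t)" by (simp add: g_def)
qed

lemma displacement_le: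
  assumes i: "i \<in> {0..N}" and "0 \<le> s" "s \<le> t"
    and V: "\<And>u. u \<in> {s..t} \<Longrightarrow> norm (velocity i u) \<le> V"
  shows "norm (x i t - x i s) \<le> V * (t - s)"
proof (rule norm_diff_le_speed[OF \<open>s \<le> t\<close> abs_continuous_x[OF i \<open>0 \<le> s\<close>]])
  show "AE u in lebesgue. u \<in> {s..t} \<longrightarrow>
      (\<exists>v. (x i has_vector_derivative v) (at u within {s..t}) \<and> norm v \<le> V)"
    using velocity_derivative[OF \<open>0 \<le> s\<close>]
    by (rule eventually_mono) (use i V in blast)
qed

text \<open>Over a window of length at most \<open>tb\<close> the displacements are bounded by \<open>tb\<close> times the speeds, and
  the speeds by distance and delay error. The factor \<open>exp (\<beta> * tb)\<close> is the growth of the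
  exponential weight from the end of the window back to its start. The window must lie in
  nonnegative times, where the equations hold, whence \<open>t \<ge> tb\<close>.\<close>

lemma delay_spread_improves:
  assumes dec: "decays_until \<beta> A B T Z" and t: "t \<in> {tb..T}" and "\<beta> \<ge> 0" "A > 0" "B > 0" "Z \<ge> 0"
    and coef: "Z * (tb * exp (\<beta> * tb) * ((1 + 2 * \<gamma>) * B + 2 * (1 + \<gamma>) * A)) \<le> Z' * B"
  shows "delay_spread_le t (Z' * B * exp (- \<beta> * t))"
  unfolding delay_spread_le_def
proof (intro ballI)
  fix s j assume s: "s \<in> {t - tb..t}" and j: "j \<in> {1..N}"
  define c where "c = exp (- \<beta> * (t - tb))"
  have c: "c > 0" "c = exp (\<beta> * tb) * exp (- \<beta> * t)"
    by (auto simp: c_def exp_add[symmetric] algebra_simps)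
  have b: "leader_dist N x u \<le> Z * A * c" "delay_spread_le u (Z * B * c)" if "u \<in> {s..t}" for u
  proof -
    have "\<beta> * (t - tb) \<le> \<beta> * u" using that s \<open>\<beta> \<ge> 0\<close> by (intro mult_left_mono) auto
    then have e: "exp (- \<beta> * u) \<le> c" by (simp add: c_def)
    have "u \<in> {0..T}" using that s t by auto
    then have "leader_dist N x u \<le> Z * A * exp (- \<beta> * u)" "delay_spread_le u (Z * B * exp (- \<beta> * u))"
      using dec by (auto simp: decays_until_def)
    moreover have "Z * A * exp (- \<beta> * u) \<le> Z * A * c" "Z * B * exp (- \<beta> * u) \<le> Z * B * c"
      using e assms by (auto intro!: mult_left_mono)
    ultimately show "leader_dist N x u \<le> Z * A * c" "delay_spread_le u (Z * B * c)"
      by (auto intro: delay_spread_le_mono)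
  qed
  define v0 v1 where "v0 = \<gamma> / 2 * (Z * B * c + Z * A * c)"
    and "v1 = (1 + \<gamma>) * (Z * B * c) + (2 + \<gamma>) * (Z * A * c)"
  have nonneg: "0 \<le> Z * B * c" "0 \<le> Z * A * c" using assms c(1) by (auto intro!: mult_nonneg_nonneg)
  have s0: "0 \<le> s" "s \<le> t" "t - s \<le> tb" using s t by auto
  have "norm (x 0 t - x 0 s) \<le> v0 * (t - s)"
  proof (rule displacement_le)
    fix u assume u: "u \<in> {s..t}"
    then have "norm (velocity 0 u) \<le> \<gamma> / 2 * (Z * B * c + leader_dist N x u)"
      using s0 b(2) by (intro norm_velocity_leader_le) auto
    also have "\<dots> \<le> v0" unfolding v0_def using b(1)[OF u] gamma by (intro mult_left_mono) auto
    finally show "norm (velocity 0 u) \<le> v0" .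
  qed (use s0 in auto)
  moreover have "norm (x j t - x j s) \<le> v1 * (t - s)"
  proof (rule displacement_le)
    fix u assume u: "u \<in> {s..t}"
    then have "norm (velocity j u) \<le> (1 + \<gamma>) * (Z * B * c) + (2 + \<gamma>) * leader_dist N x u"
      using s0 b(2) j by (intro norm_velocity_agent_le) auto
    also have "\<dots> \<le> v1" unfolding v1_def using b(1)[OF u] gamma by (intro add_left_mono mult_left_mono) auto
    finally show "norm (velocity j u) \<le> v1" .
  qed (use s0 j in auto)
  ultimately have "norm (x 0 t - x 0 s) + norm (x j t - x j s) \<le> (v0 + v1) * (t - s)"
    by (simp add: algebra_simps)
  also have "\<dots> \<le> ((1 + 2 * \<gamma>) * (Z * B * c) + 2 * (1 + \<gamma>) * (Z * A * c)) * tb"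
  proof (rule mult_mono)
    have "\<gamma> * (Z * B * c) \<ge> 0" "\<gamma> * (Z * A * c) \<ge> 0" using gamma nonneg by auto
    then show "v0 + v1 \<le> (1 + 2 * \<gamma>) * (Z * B * c) + 2 * (1 + \<gamma>) * (Z * A * c)"
      by (simp add: v0_def v1_def algebra_simps)
    show "0 \<le> (1 + 2 * \<gamma>) * (Z * B * c) + 2 * (1 + \<gamma>) * (Z * A * c)"
      using gamma by (intro add_nonneg_nonneg mult_nonneg_nonneg[OF _ nonneg(1)] mult_nonneg_nonneg[OF _ nonneg(2)]) auto
  qed (use s0 in auto)
  also have "\<dots> = Z * (tb * exp (\<beta> * tb) * ((1 + 2 * \<gamma>) * B + 2 * (1 + \<gamma>) * A)) * exp (- \<beta> * t)"
    unfolding c(2) by (simp add: algebra_simps)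
  also have "\<dots> \<le> Z' * B * exp (- \<beta> * t)" by (intro mult_right_mono coef) auto
  finally show "norm (x 0 t - x 0 s) + norm (x j t - x j s) \<le> Z' * B * exp (- \<beta> * t)" .
qed

text \<open>The estimates for distance and delay error feed each other. If \<open>A\<close> and \<open>B\<close> balance them so that
  one round of improvement multiplies \<open>Z\<close> by \<open>k < 1\<close>, down to a floor \<open>C\<close> imposed by the initial
  window, then finitely many rounds lower any constant to \<open>C\<close>. The starting constant depends on the
  time horizon, but \<open>C\<close> does not.\<close>

lemma decays_if_contraction:
  assumes "\<beta> \<ge> 0" "A > 0" "B > 0" and k: "0 \<le> k" "k < 1" and "\<beta> \<le> 1 + \<gamma>"
    and coefA: "(1 + \<gamma> - \<gamma> * \<phi> (2 * R) / 2) * A + (\<gamma> * L * R + \<gamma> + 1) * B \<le> k * ((1 + \<gamma> - \<beta>) * A)"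
    and coefB: "tb * exp (\<beta> * tb) * ((1 + 2 * \<gamma>) * B + 2 * (1 + \<gamma>) * A) \<le> k * B"
  obtains C where "C > 0" "\<And>t. t \<ge> 0 \<Longrightarrow> leader_dist N x t \<le> C * exp (- \<beta> * t)"
proof -
  define c where "c = 2 * R / A + 4 * R / B + 1"
  have c: "c > 0" unfolding c_def using R_nonneg assms by (intro add_nonneg_pos add_nonneg_nonneg) auto
  define C where "C = exp (\<beta> * tb) * c"
  have C: "C > 0" "c \<le> C" using c tb \<open>\<beta> \<ge> 0\<close> by (auto simp: C_def)
  have start: "decays_until \<beta> A B tb C"
    unfolding C_def c_def using assms tb by (intro decays_until_initially) auto
  have improve: "decays_until \<beta> A B T (max C (k * Z))" if dec: "decays_until \<beta> A B T Z" and "Z \<ge> 0" for T Z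
    unfolding decays_until_def
  proof (intro ballI conjI)
    let ?Z = "max C (k * Z)"
    have Z: "k * Z \<le> ?Z" "0 \<le> ?Z" "C \<le> ?Z" using C by auto
    fix t assume t: "t \<in> {0..T}"
    show "leader_dist N x t \<le> ?Z * A * exp (- \<beta> * t)"
    proof (rule leader_dist_improves[OF dec t])
      have "leader_dist N x 0 \<le> C * A" using start[unfolded decays_until_def, rule_format, of 0] tb by simp
      also have "\<dots> \<le> ?Z * A" using Z \<open>A > 0\<close> by (intro mult_right_mono) auto
      finally show "leader_dist N x 0 \<le> ?Z * A" .
      have "Z * ((1 + \<gamma> - \<gamma> * \<phi> (2 * R) / 2) * A + (\<gamma> * L * R + \<gamma> + 1) * B) \<le> Z * (k * ((1 + \<gamma> - \<beta>) * A))"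
        by (intro mult_left_mono coefA \<open>Z \<ge> 0\<close>)
      also have "\<dots> = k * Z * ((1 + \<gamma> - \<beta>) * A)" by (simp add: mult_ac)
      also have "\<dots> \<le> ?Z * ((1 + \<gamma> - \<beta>) * A)" using Z assms by (intro mult_right_mono) auto
      finally show "Z * ((1 + \<gamma> - \<gamma> * \<phi> (2 * R) / 2) * A + (\<gamma> * L * R + \<gamma> + 1) * B) \<le> (1 + \<gamma> - \<beta>) * (?Z * A)"
        by (simp add: mult_ac)
    qed (use assms Z in auto)
    show "delay_spread_le t (?Z * B * exp (- \<beta> * t))"
    proof (cases "t \<le> tb")
      case True
      then have "delay_spread_le t (C * B * exp (- \<beta> * t))" using start t by (auto simp: decays_until_def)
      then show ?thesis
        by (rule delay_spread_le_mono) (use Z assms in \<open>auto intro!: mult_right_mono\<close>)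
    next
      case False
      have "Z * (tb * exp (\<beta> * tb) * ((1 + 2 * \<gamma>) * B + 2 * (1 + \<gamma>) * A)) \<le> Z * (k * B)"
        by (intro mult_left_mono coefB \<open>Z \<ge> 0\<close>)
      also have "\<dots> = k * Z * B" by (simp add: mult_ac)
      also have "\<dots> \<le> ?Z * B" using Z assms by (intro mult_right_mono) auto
      finally show ?thesis using False t assms \<open>Z \<ge> 0\<close>
        by (intro delay_spread_improves[OF dec]) auto
    qed
  qed
  have "leader_dist N x t \<le> C * A * exp (- \<beta> * t)" if "t \<ge> 0" for t
  proof -
    define Z where "Z = exp (\<beta> * t) * c"
    have "Z > 0" using c by (simp add: Z_def)
    have "decays_until \<beta> A B t (max C (k ^ n * Z))" for n
    proof (induction n)
      case 0
      \<comment> \<open>The crude bound on \<open>{0..t}\<close>; its constant grows with \<open>t\<close>.\<close>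
      have "decays_until \<beta> A B t Z"
        unfolding Z_def c_def using assms that by (intro decays_until_initially) auto
      then have "decays_until \<beta> A B t (max C Z)"
        unfolding decays_until_def
        by (fastforce intro: order_trans delay_spread_le_mono mult_right_mono simp: assms less_imp_le)
      then show ?case by simp
    next
      case (Suc n)
      have "decays_until \<beta> A B t (max C (k * max C (k ^ n * Z)))"
        using improve[OF Suc] C by auto
      moreover have "max C (k * max C (k ^ n * Z)) = max C (k ^ Suc n * Z)"
      proof -
        have "k * C \<le> C" using k C mult_right_mono[of k 1 C] by simp
        moreover have "k * max C (k ^ n * Z) = max (k * C) (k ^ Suc n * Z)"
          using k by (simp add: max_mult_distrib_left mult.assoc)
        ultimately show ?thesis by simp
      qed
      ultimately show ?case by simp
    qed
    moreover obtain n where "k ^ n < C / Z"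
      using real_arch_pow_inv[of "C / Z" k] C \<open>Z > 0\<close> k by auto
    then have "max C (k ^ n * Z) = C" using \<open>Z > 0\<close> by (simp add: field_simps)
    ultimately have "decays_until \<beta> A B t C" by metis
    then show ?thesis using that by (auto simp: decays_until_def)
  qed
  then show thesis using that[of "C * A"] C \<open>A > 0\<close> by auto
qed

text \<open>Put \<open>P = \<gamma> * \<phi> (2 * R)\<close> and \<open>Rg = \<gamma> * L * R + \<gamma> + 1\<close>. The distance estimate contracts as soon as
  \<open>Rg * B\<close> is below \<open>(P / 2 - \<beta>) * A\<close>. The choice \<open>A = 2 * Rg\<close>, \<open>B = P - 4 * \<beta>\<close> gives this with the
  factor \<open>(1 + \<gamma> - 2 * \<beta>) / (1 + \<gamma> - \<beta>)\<close>; the rate enters with the factor four rather than two to make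
  the inequality strict. The estimate for the delay error then contracts if and only if \<open>F \<beta> < 0\<close>,
  where \<open>F\<close> is the function defined in the proof. At \<open>\<beta> = 0\<close> this is the smallness assumption, and
  by continuity it persists for small positive \<open>\<beta>\<close>.\<close>

theorem exponential_following:
  assumes small: "tb * (\<gamma> * (1 + 2 * \<gamma>) * \<phi> (2 * R) + 4 * (1 + \<gamma>) * (\<gamma> * L * R + \<gamma> + 1)) < \<gamma> * \<phi> (2 * R)"
  shows "\<exists>\<beta> C. \<beta> > 0 \<and> C > 0 \<and> (\<forall>t\<ge>0. leader_dist N x t \<le> C * exp (- \<beta> * t))"
proof -
  define P Rg where "P = \<gamma> * \<phi> (2 * R)" and "Rg = \<gamma> * L * R + \<gamma> + 1"
  have P: "0 < P" "P \<le> \<gamma>"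
    using gamma phi_pos[of "2 * R"] phi_le_1[of "2 * R"] R_nonneg by (auto simp: P_def)
  have Rg: "Rg > 0" unfolding Rg_def using gamma L_nonneg R_nonneg by (intro add_nonneg_pos add_nonneg_nonneg mult_nonneg_nonneg) auto
  define F where "F \<beta> = tb * exp (\<beta> * tb) * ((1 + 2 * \<gamma>) * (P - 4 * \<beta>) + 2 * (1 + \<gamma>) * (2 * Rg)) - (P - 4 * \<beta>)" for \<beta>
  have "(F \<longlongrightarrow> F 0) (at_right 0)"
    unfolding F_def by (auto intro!: tendsto_eq_intros)
  moreover have "F 0 < 0" using small unfolding F_def P_def[symmetric] Rg_def[symmetric]
    by (simp add: P_def algebra_simps)
  ultimately have "\<forall>\<^sub>F \<beta> in at_right 0. F \<beta> < 0" by (rule order_tendstoD)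
  moreover have "\<forall>\<^sub>F \<beta> in at_right (0::real). \<beta> < P / 4"
    using P by (intro order_tendstoD[OF tendsto_ident_at]) auto
  moreover have "\<forall>\<^sub>F \<beta> in at_right (0::real). \<beta> > 0"
    by (simp add: eventually_at_right_less)
  ultimately have "\<forall>\<^sub>F \<beta> in at_right 0. F \<beta> < 0 \<and> \<beta> < P / 4 \<and> \<beta> > 0" by eventually_elim auto
  then obtain \<beta> where \<beta>: "F \<beta> < 0" "\<beta> < P / 4" "\<beta> > 0"
    using eventually_happens'[OF trivial_limit_at_right_real] by blast
  define A B where "A = 2 * Rg" and "B = P - 4 * \<beta>"
  have AB: "A > 0" "B > 0" using Rg \<beta> by (auto simp: A_def B_def)
  \<comment> \<open>The contraction factors of the distance and of the delay error.\<close>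
  define k where "k = max ((1 + \<gamma> - 2 * \<beta>) / (1 + \<gamma> - \<beta>)) ((F \<beta> + B) / B)"
  have g\<beta>: "1 + \<gamma> - 2 * \<beta> > 0" "1 + \<gamma> - \<beta> > 0" using \<beta> P by auto
  have "k < 1" using \<beta> g\<beta> AB by (auto simp: k_def)
  have "0 \<le> (1 + \<gamma> - 2 * \<beta>) / (1 + \<gamma> - \<beta>)" using g\<beta> by simp
  then have "0 \<le> k" by (simp add: k_def)
  have kA: "1 + \<gamma> - 2 * \<beta> \<le> k * (1 + \<gamma> - \<beta>)"
    using g\<beta> by (simp add: k_def pos_divide_le_eq[symmetric])
  have kB: "F \<beta> + B \<le> k * B" using AB by (simp add: k_def pos_divide_le_eq[symmetric])
  obtain C where "C > 0" "\<And>t. t \<ge> 0 \<Longrightarrow> leader_dist N x t \<le> C * exp (- \<beta> * t)"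
  proof (rule decays_if_contraction[of \<beta> A B k])
    have "(1 + \<gamma> - P / 2) * A + Rg * B = (1 + \<gamma> - 2 * \<beta>) * A"
      by (simp add: A_def B_def algebra_simps)
    also have "\<dots> \<le> k * (1 + \<gamma> - \<beta>) * A" using AB kA by (intro mult_right_mono) auto
    finally show "(1 + \<gamma> - \<gamma> * \<phi> (2 * R) / 2) * A + (\<gamma> * L * R + \<gamma> + 1) * B \<le> k * ((1 + \<gamma> - \<beta>) * A)"
      by (simp add: P_def Rg_def mult.assoc)
    show "tb * exp (\<beta> * tb) * ((1 + 2 * \<gamma>) * B + 2 * (1 + \<gamma>) * A) \<le> k * B"
      using kB by (simp add: F_def A_def B_def)
  qed (use \<beta> AB \<open>0 \<le> k\<close> \<open>k < 1\<close> g\<beta> in auto)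
  then show ?thesis using \<beta>(3) by blast
qed

end

text \<open>Since \<open>tb \<le> exp tb - 1\<close>, the logarithmic condition implies the linear one of the preceding
  theorem.\<close>

theorem theorem2p5:
  fixes N :: nat
    and \<gamma> M tb L \<delta> r R R\<gamma> :: real
    and \<tau> a \<phi> :: "real \<Rightarrow> real"
    and x_init x :: "nat \<Rightarrow> real \<Rightarrow> real ^ 'd"
    and p :: "real \<Rightarrow> nat"
  assumes "N \<ge> 1" and "\<gamma> > 0" and "M > 0" and "tb > 0"
    and tau: "continuous_on {0..} \<tau>" "\<And>t. t \<ge> 0 \<Longrightarrow> 0 \<le> \<tau> t \<and> \<tau> t \<le> tb"
    and a: "0 < \<delta>" "\<delta> < r" "continuous_on {0..} a" "antimono_on {0..} a"
      "\<And>s. s \<ge> 0 \<Longrightarrow> a s \<ge> 0"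
      "\<And>s. 0 \<le> s \<Longrightarrow> s \<le> \<delta> \<Longrightarrow> a s = 1" "\<And>s. s \<ge> r \<Longrightarrow> a s = 0"
    and phi: "antimono_on {0..} \<phi>" "L > 0" "L-lipschitz_on {0..} \<phi>"
      "\<And>s. s \<ge> 0 \<Longrightarrow> \<phi> s > 0" "\<phi> 0 = 1"
    and init: "\<And>i. i \<in> {0..N} \<Longrightarrow> continuous_on {-tb..0} (x_init i)"
    and sel: "farthest_selection N x p"
    and sol: "solves_P N \<gamma> tb \<tau> a \<phi> x_init (feedback_control N \<gamma> M \<tau> \<phi> x p) x"
    and R: "R = initial_radius N tb x"
    and R\<gamma>: "R\<gamma> = \<gamma> * L * R + \<gamma> + 1"
    and small_delay: "tb < ln (1 + \<gamma> * \<phi> (2 * R) /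
      (\<gamma> * (1 + 2 * \<gamma>) * \<phi> (2 * R) + 4 * (1 + \<gamma>) * R\<gamma>))"
  shows "\<exists>\<beta> C. \<beta> > 0 \<and> C > 0 \<and> (\<forall>t\<ge>0. leader_dist N x t \<le> C * exp (- \<beta> * t))"
proof -
  have a_le_1: "a s \<le> 1" if "s \<ge> 0" for s
    using monotone_onD[OF a(4), of 0 s] that a(6)[of 0] a(1) by simp
  interpret delayed_leader_following N \<gamma> M tb L R \<tau> a \<phi> x_init x p
    by unfold_locales (use assms a_le_1 in auto)
  define Q where "Q = \<gamma> * (1 + 2 * \<gamma>) * \<phi> (2 * R) + 4 * (1 + \<gamma>) * R\<gamma>"
  have "0 < \<phi> (2 * R)" using R_nonneg phi(4) by simp
  moreover have "R\<gamma> > 0"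
    unfolding R\<gamma> using \<open>\<gamma> > 0\<close> \<open>L > 0\<close> R_nonneg by (intro add_nonneg_pos add_nonneg_nonneg mult_nonneg_nonneg) auto
  ultimately have pos: "\<gamma> * \<phi> (2 * R) > 0" "Q > 0"
    unfolding Q_def using \<open>\<gamma> > 0\<close> by (auto intro!: add_pos_pos mult_pos_pos)
  \<comment> \<open>Here \<open>Q\<close> is the denominator of the fraction in the condition on \<open>tb\<close>.\<close>
  have "1 + tb \<le> exp tb" by (rule exp_ge_add_one_self)
  also have "exp tb < exp (ln (1 + \<gamma> * \<phi> (2 * R) / Q))"
    using small_delay by (simp add: Q_def)
  also have "\<dots> = 1 + \<gamma> * \<phi> (2 * R) / Q" using pos by (simp add: add_pos_pos)
  finally have "tb * Q < \<gamma> * \<phi> (2 * R)" using pos by (simp add: field_simps)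
  then show ?thesis unfolding Q_def R\<gamma> by (rule exponential_following)
qed

end
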